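(* Let $p\in[0,1]$ satisfy $p\ge_T\emptyset'$. Then there is $y\notin\mathsf{MLR}_{\mu_p}$ such that no blind $p$-supermartingale succeeds on $y$.
   Context: For $p\in[0,1]$ the Bernoulli measure $\mu_p$ on $2^\omega$ is determined by $\mu_p(\sigma)=p^{\#_0(\sigma)}(1-p)^{\#_1(\sigma)}$, where $\#_i(\sigma)$ is the number of occurrences of $i$ in $\sigma$; $p$ is identified with its binary expansion. $\mathsf{MLR}_{\mu_p}$ is the set of sequences Martin-Löf random for $\mu_p$ relative to oracle $p$. A semimeasure is $\delta:2^{<\omega}\to[0,1]$ with $\delta(\emptyset)\le1$ and $\delta(\sigma)\ge\delta(\sigma0)+\delta(\sigma1)$; it is left-c.e. (unrelativized) if its values are uniformly limits of computable nondecreasing sequences of rationals. A blind $p$-supermartingale is a function of the form $M=\delta/\mu_p$ (i.e. $M(\sigma)=\delta(\sigma)/\mu_p(\sigma)$) where $\delta$ is a left-c.e. semimeasure. $M$ succeeds on $y$ if $\limsup_n M(y\upharpoonright n)=\infty$. *)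

theory Defs
  imports "HOL-Probability.Probability" "HOL-Library.Nat_Bijection"
begin

datatype recf = Zero | Succ | Proj nat | Orc | Comp recf "recf list" | Prec recf recf | Mn recf

inductive eval :: "(nat \<Rightarrow> bool) \<Rightarrow> recf \<Rightarrow> nat list \<Rightarrow> nat \<Rightarrow> bool" for A where
  ev_zero: "eval A Zero xs 0"
| ev_succ: "eval A Succ (x # xs) (Suc x)"
| ev_proj: "i < length xs \<Longrightarrow> eval A (Proj i) xs (xs ! i)"
| ev_orc: "eval A Orc (x # xs) (if A x then 1 else 0)"
| ev_comp: "list_all2 (\<lambda>g y. eval A g xs y) gs ys \<Longrightarrow> eval A f ys z \<Longrightarrow> eval A (Comp f gs) xs z"
| ev_prec0: "eval A g xs y \<Longrightarrow> eval A (Prec g h) (0 # xs) y"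
| ev_precS: "eval A (Prec g h) (n # xs) y \<Longrightarrow> eval A h (n # y # xs) z
             \<Longrightarrow> eval A (Prec g h) (Suc n # xs) z"
| ev_mn: "eval A f (n # xs) 0 \<Longrightarrow> (\<forall>m<n. \<exists>k. eval A f (m # xs) (Suc k))
          \<Longrightarrow> eval A (Mn f) xs n"

definition no_oracle :: "nat \<Rightarrow> bool" where "no_oracle = (\<lambda>_. False)"

fun code :: "recf \<Rightarrow> nat" where
  "code Zero = prod_encode (0, 0)"
| "code Succ = prod_encode (1, 0)"
| "code (Proj i) = prod_encode (2, i)"
| "code Orc = prod_encode (3, 0)"
| "code (Comp f gs) = prod_encode (4, prod_encode (code f, list_encode (map code gs)))"
| "code (Prec g h) = prod_encode (5, prod_encode (code g, code h))"
| "code (Mn f) = prod_encode (6, code f)"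

definition halting_set :: "nat set" where
  "halting_set = {e. \<exists>f y. code f = e \<and> eval no_oracle f [e] y}"

definition turing_red :: "nat set \<Rightarrow> (nat \<Rightarrow> bool) \<Rightarrow> bool" where
  "turing_red X A \<longleftrightarrow> (\<exists>f. \<forall>n. eval A f [n] (if n \<in> X then 1 else 0))"

definition ce_in :: "(nat \<Rightarrow> bool) \<Rightarrow> (nat \<Rightarrow> bool) \<Rightarrow> bool" where
  "ce_in A R \<longleftrightarrow> (\<exists>f. \<forall>x. R x \<longleftrightarrow> (\<exists>y. eval A f [x] y))"

text \<open>Binary expansion of p in [0,1]: bit n is the (n+1)-th binary digit
  (for dyadic rationals, the expansion ending in zeros).\<close>
definition pbit :: "real \<Rightarrow> nat \<Rightarrow> bool" where
  "pbit p n = odd (\<lfloor>p * 2 ^ (Suc n)\<rfloor>)"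

definition str_code :: "bool list \<Rightarrow> nat" where
  "str_code \<sigma> = list_encode (map of_bool \<sigma>)"

definition count0 :: "bool list \<Rightarrow> nat" where
  "count0 \<sigma> = length (filter (\<lambda>b. \<not> b) \<sigma>)"

definition count1 :: "bool list \<Rightarrow> nat" where
  "count1 \<sigma> = length (filter (\<lambda>b. b) \<sigma>)"

definition mu_str :: "real \<Rightarrow> bool list \<Rightarrow> real" where
  "mu_str p \<sigma> = p ^ count0 \<sigma> * (1 - p) ^ count1 \<sigma>"

text \<open>The Bernoulli measure mu_p on Cantor space (each bit is 0 with probability p).\<close>
definition bern :: "real \<Rightarrow> (nat \<Rightarrow> bool) measure" where
  "bern p = PiM UNIV (\<lambda>_::nat. measure_pmf (bernoulli_pmf (1 - p)))"

definition prefix :: "(nat \<Rightarrow> bool) \<Rightarrow> nat \<Rightarrow> bool list" where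
  "prefix y n = map y [0..<n]"

definition cyl :: "bool list set \<Rightarrow> (nat \<Rightarrow> bool) set" where
  "cyl S = {y. \<exists>\<sigma>\<in>S. prefix y (length \<sigma>) = \<sigma>}"

definition mlr_test :: "real \<Rightarrow> (nat \<Rightarrow> bool list \<Rightarrow> bool) \<Rightarrow> bool" where
  "mlr_test p U \<longleftrightarrow>
     (\<exists>R. ce_in (pbit p) R \<and> (\<forall>n \<sigma>. U n \<sigma> \<longleftrightarrow> R (prod_encode (n, str_code \<sigma>))))
     \<and> (\<forall>n. emeasure (bern p) (cyl {\<sigma>. U n \<sigma>}) \<le> ennreal ((1/2) ^ n))"

definition MLR :: "real \<Rightarrow> (nat \<Rightarrow> bool) set" where
  "MLR p = {y. \<not> (\<exists>U. mlr_test p U \<and> (\<forall>n. y \<in> cyl {\<sigma>. U n \<sigma>}))}"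

definition semimeasure :: "(bool list \<Rightarrow> real) \<Rightarrow> bool" where
  "semimeasure \<delta> \<longleftrightarrow> (\<forall>\<sigma>. 0 \<le> \<delta> \<sigma> \<and> \<delta> \<sigma> \<le> 1) \<and> \<delta> [] \<le> 1
     \<and> (\<forall>\<sigma>. \<delta> (\<sigma> @ [False]) + \<delta> (\<sigma> @ [True]) \<le> \<delta> \<sigma>)"

definition rat_of_code :: "nat \<Rightarrow> real" where
  "rat_of_code v = real_of_int (int_decode (fst (prod_decode v))) / real (Suc (snd (prod_decode v)))"

definition left_ce :: "(bool list \<Rightarrow> real) \<Rightarrow> bool" where
  "left_ce \<delta> \<longleftrightarrow> (\<exists>f q. (\<forall>\<sigma> s. eval no_oracle f [prod_encode (str_code \<sigma>, s)] (q \<sigma> s))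
       \<and> (\<forall>\<sigma>. incseq (\<lambda>s. rat_of_code (q \<sigma> s)))
       \<and> (\<forall>\<sigma>. (\<lambda>s. rat_of_code (q \<sigma> s)) \<longlonglongrightarrow> \<delta> \<sigma>))"

definition blind_mart :: "real \<Rightarrow> (bool list \<Rightarrow> real) \<Rightarrow> bool list \<Rightarrow> real" where
  "blind_mart p \<delta> \<sigma> = \<delta> \<sigma> / mu_str p \<sigma>"

definition succeeds :: "(bool list \<Rightarrow> real) \<Rightarrow> (nat \<Rightarrow> bool) \<Rightarrow> bool" where
  "succeeds M y \<longleftrightarrow> limsup (\<lambda>n. ereal (M (prefix y n))) = \<infinity>"

end

(* The measure mu_p is replaced by a product measure nu with rational values computed from the
   bits of p, which is at most a constant times mu_p.  If Delta(tau) <= c nu(tau) and Delta is a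
   left-c.e. semimeasure, then the semidecidable question "Delta(tau0) > c nu(tau0)?" selects a
   bit that preserves the inequality.  Bit by bit this makes a sequence y that keeps finitely
   many semimeasures bounded by nu; new ones are added, with small weights, at later stages.
   Each stage is described by the index e_n of one oracle-free program answering all questions
   asked so far.  Since p computes the halting set, p computes from e the string that program e
   leads to.  The length of stage n is chosen so large, depending on e_n, that
   the strings of length K (n + 1 + e) obtained from all numbers e have total measure at most
   2^-n; together they form a Martin-Loef test that y fails. *)
theory Submission
  imports Defs
begin

section \<open>Computable functions\<close>

inductive_cases eval_ZeroE: "eval A Zero xs y"
inductive_cases eval_SuccE: "eval A Succ xs y"
inductive_cases eval_ProjE: "eval A (Proj i) xs y"
inductive_cases eval_OrcE: "eval A Orc xs y"
inductive_cases eval_CompE: "eval A (Comp f gs) xs y"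
inductive_cases eval_Prec0E: "eval A (Prec g h) (0 # xs) y"
inductive_cases eval_PrecSE: "eval A (Prec g h) (Suc n # xs) y"
inductive_cases eval_MnE: "eval A (Mn f) xs y"

text \<open>Lets the proof read off values from programs and identify a left-c.e. function with any
  program for it.\<close>

lemma eval_deterministic: "eval A f xs y \<Longrightarrow> eval A f xs z \<Longrightarrow> y = z"
proof (induction arbitrary: z rule: eval.induct)
  case (ev_zero xs)
  then show ?case by (auto elim: eval_ZeroE)
next
  case (ev_succ x xs)
  then show ?case by (auto elim: eval_SuccE)
next
  case (ev_proj i xs)
  then show ?case by (auto elim: eval_ProjE)
next
  case (ev_orc x xs)
  then show ?case by (auto elim: eval_OrcE)
next
  case (ev_comp xs gs ys f w)
  from ev_comp.prems obtain ys' where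
    ys': "list_all2 (\<lambda>g y. eval A g xs y) gs ys'" "eval A f ys' z"
    by (auto elim: eval_CompE)
  have "ys = ys'"
    using ev_comp.IH(1) ys'(1)
    by (auto simp: list_all2_conv_all_nth intro!: nth_equalityI)
  then show ?case using ev_comp.IH(2) ys'(2) by simp
next
  case (ev_prec0 g xs y h)
  from ev_prec0.prems have "eval A g xs z" by (rule eval_Prec0E)
  with ev_prec0.IH show ?case .
next
  case (ev_precS g h n xs y w)
  from ev_precS.prems obtain y' where "eval A (Prec g h) (n # xs) y'" "eval A h (n # y' # xs) z"
    by (rule eval_PrecSE)
  with ev_precS.IH show ?case by blast
next
  case (ev_mn f n xs)
  from ev_mn.prems have z0: "eval A f (z # xs) 0" "\<forall>m<z. \<exists>k. eval A f (m # xs) (Suc k)"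
    by (auto elim: eval_MnE)
  \<comment> \<open>If two outputs of \<open>Mn f\<close> differed, minimality of the larger one
    would give \<open>f\<close> a successor value at the smaller one, where its value is 0.\<close>
  show ?case
  proof (cases n z rule: linorder_cases)
    case less
    then show ?thesis using z0(2) ev_mn.IH(1) by blast
  next
    case greater
    then show ?thesis using z0(1) ev_mn.IH(2) by blast
  qed
qed

section \<open>Closure properties of total functions with an oracle, for every arity\<close>

definition cfun :: "(nat \<Rightarrow> bool) \<Rightarrow> nat \<Rightarrow> (nat list \<Rightarrow> nat) \<Rightarrow> bool" where
  "cfun A n F \<longleftrightarrow> (\<exists>f. \<forall>xs. length xs = n \<longrightarrow> eval A f xs (F xs))"

lemma cfun_proj: "i < n \<Longrightarrow> cfun A n (\<lambda>xs. xs ! i)"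
  unfolding cfun_def by (intro exI[of _ "Proj i"]) (auto intro: ev_proj)

lemma cfun_comp:
  assumes "cfun A (length Gs) F" "\<forall>G\<in>set Gs. cfun A n G"
  shows "cfun A n (\<lambda>xs. F (map (\<lambda>G. G xs) Gs))"
proof -
  obtain f where f: "\<And>xs. length xs = length Gs \<Longrightarrow> eval A f xs (F xs)"
    using assms(1) unfolding cfun_def by blast
  have "\<exists>c. \<forall>G\<in>set Gs. \<forall>xs. length xs = n \<longrightarrow> eval A (c G) xs (G xs)"
    using assms(2) unfolding cfun_def by (intro bchoice)
  then obtain c where c: "\<And>G xs. G \<in> set Gs \<Longrightarrow> length xs = n \<Longrightarrow> eval A (c G) xs (G xs)"
    by blast
  have "eval A (Comp f (map c Gs)) xs (F (map (\<lambda>G. G xs) Gs))" if "length xs = n" for xs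
    using that by (intro ev_comp[of _ _ _ "map (\<lambda>G. G xs) Gs"] f)
      (auto simp: list_all2_conv_all_nth intro!: c)
  then show ?thesis unfolding cfun_def by blast
qed

text \<open>\<open>Prec\<close> counts on its first argument and passes the others on. Composing it
  with \<open>B\<close> and the projections makes the recursion depth an arbitrary computable
  function of the same arguments.\<close>

lemma cfun_rec:
  assumes "cfun A n G" "cfun A (Suc (Suc n)) H" "cfun A n B"
  shows "cfun A n (\<lambda>xs. rec_nat (G xs) (\<lambda>i y. H (i # y # xs)) (B xs))"
proof -
  obtain g h where g: "\<And>xs. length xs = n \<Longrightarrow> eval A g xs (G xs)"
    and h: "\<And>xs. length xs = Suc (Suc n) \<Longrightarrow> eval A h xs (H xs)"
    using assms unfolding cfun_def by blast
  have *: "eval A (Prec g h) (k # xs) (rec_nat (G xs) (\<lambda>i y. H (i # y # xs)) k)"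
    if "length xs = n" for k xs
    using that by (induction k) (auto intro!: ev_prec0 ev_precS g h)
  let ?F = "\<lambda>zs. rec_nat (G (tl zs)) (\<lambda>i y. H (i # y # tl zs)) (hd zs)"
  have "cfun A (Suc n) ?F"
    unfolding cfun_def
  proof (intro exI[of _ "Prec g h"] allI impI)
    fix zs :: "nat list" assume "length zs = Suc n"
    then show "eval A (Prec g h) zs (?F zs)" using * by (cases zs) auto
  qed
  moreover define Gs where "Gs = B # map (\<lambda>i xs. xs ! i) [0..<n]"
  ultimately have "cfun A n (\<lambda>xs. ?F (map (\<lambda>G. G xs) Gs))"
    using assms(3) by (intro cfun_comp) (auto intro: cfun_proj)
  then obtain f where "\<And>xs. length xs = n \<Longrightarrow> eval A f xs (?F (map (\<lambda>G. G xs) Gs))"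
    unfolding cfun_def by blast
  moreover have "tl (map (\<lambda>G. G xs) Gs) = xs" if "length xs = n" for xs
    using that by (auto simp: Gs_def intro: nth_equalityI)
  ultimately show ?thesis
    unfolding cfun_def by (intro exI[of _ f]) (auto simp: Gs_def)
qed

lemma cfun_Suc: "cfun A n F \<Longrightarrow> cfun A n (\<lambda>xs. Suc (F xs))"
proof -
  have "cfun A 1 (\<lambda>xs. Suc (hd xs))"
    unfolding cfun_def
  proof (intro exI[of _ Succ] allI impI)
    fix xs :: "nat list" assume "length xs = 1"
    then show "eval A Succ xs (Suc (hd xs))" by (cases xs) (auto intro: ev_succ)
  qed
  then show "cfun A n F \<Longrightarrow> ?thesis" using cfun_comp[of A "[F]" "\<lambda>xs. Suc (hd xs)" n] by simp
qed

lemma cfun_orc: "cfun A n F \<Longrightarrow> cfun A n (\<lambda>xs. of_bool (A (F xs)))"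
proof -
  have "cfun A 1 (\<lambda>xs. of_bool (A (hd xs)))"
    unfolding cfun_def
  proof (intro exI[of _ Orc] allI impI)
    fix xs :: "nat list" assume "length xs = 1"
    then show "eval A Orc xs (of_bool (A (hd xs)))"
      using ev_orc[of A "hd xs" "tl xs"] by (cases xs) (auto simp: of_bool_def)
  qed
  then show "cfun A n F \<Longrightarrow> ?thesis"
    using cfun_comp[of A "[F]" "\<lambda>xs. of_bool (A (hd xs))" n] by simp
qed

lemma cfun_0: "cfun A n (\<lambda>_. 0)"
  unfolding cfun_def by (intro exI[of _ Zero]) (auto intro: ev_zero)

lemma cfun_const: "cfun A n (\<lambda>_. c)"
  by (induction c) (auto intro: cfun_0 cfun_Suc)

lemma cfun_add:
  assumes "cfun A n F" "cfun A n G"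
  shows "cfun A n (\<lambda>xs. F xs + G xs)"
proof -
  have "rec_nat a (\<lambda>i. Suc) b = a + b" for a b :: nat by (induction b) auto
  then show ?thesis
    using cfun_rec[OF assms(1) cfun_Suc[OF cfun_proj[of 1]] assms(2)] by simp
qed

lemma cfun_diff:
  assumes "cfun A n F" "cfun A n G"
  shows "cfun A n (\<lambda>xs. F xs - G xs)"
proof -
  have pred: "cfun A k (\<lambda>xs. H xs - 1)" if "cfun A k H" for k H
  proof -
    have "rec_nat 0 (\<lambda>i y. i) b = b - 1" for b :: nat by (cases b) auto
    then show ?thesis
      using cfun_rec[OF cfun_0 cfun_proj[of 0] that] by simp
  qed
  have "rec_nat a (\<lambda>i y. y - 1) b = a - b" for a b :: nat by (induction b) auto
  then show ?thesis
    using cfun_rec[OF assms(1) pred[OF cfun_proj[of 1]] assms(2)] by simp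
qed

lemma cfun_triangle:
  assumes "cfun A n F"
  shows "cfun A n (\<lambda>xs. triangle (F xs))"
proof -
  have "rec_nat 0 (\<lambda>i y. y + Suc i) b = triangle b" for b by (induction b) auto
  then show ?thesis
    using cfun_rec[OF cfun_0 cfun_add[OF cfun_proj[of 1] cfun_Suc[OF cfun_proj[of 0]]] assms]
    by simp
qed

section \<open>Cantor pairing and its inverse\<close>

definition pfst :: "nat \<Rightarrow> nat" where "pfst x = fst (prod_decode x)"
definition psnd :: "nat \<Rightarrow> nat" where "psnd x = snd (prod_decode x)"
abbreviation pair :: "nat \<Rightarrow> nat \<Rightarrow> nat" where "pair a b \<equiv> prod_encode (a, b)"

lemma pfst_pair [simp]: "pfst (pair a b) = a"
  and psnd_pair [simp]: "psnd (pair a b) = b"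
  and pair_pfst_psnd [simp]: "pair (pfst x) (psnd x) = x"
  by (simp_all add: pfst_def psnd_def)

text \<open>The largest r with \<open>triangle r\<close> \<le> x. With truncated subtraction, the
  increment is 1 exactly when \<open>Suc i\<close> has reached the next triangular number.\<close>

definition triangle_root :: "nat \<Rightarrow> nat" where
  "triangle_root = rec_nat 0 (\<lambda>i y. y + (1 - (triangle (Suc y) - Suc i)))"

lemma triangle_root_bounds:
  "triangle (triangle_root x) \<le> x \<and> x < triangle (Suc (triangle_root x))"
proof (induction x)
  case (Suc x)
  define r where "r = triangle_root x"
  have "triangle_root (Suc x) = r + (1 - (triangle (Suc r) - Suc x))"
    by (simp add: triangle_root_def r_def)
  moreover have "\<not> triangle (Suc r) \<le> Suc x \<or> triangle (Suc r) = Suc x"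
    using Suc unfolding r_def by linarith
  ultimately show ?case
    using Suc unfolding r_def[symmetric] by (cases "triangle (Suc r) = Suc x") auto
qed (simp add: triangle_root_def)

lemma triangle_mono: "a \<le> b \<Longrightarrow> triangle a \<le> triangle b"
  by (induction rule: dec_induct) auto

lemma triangle_root_pair: "triangle_root (pair a b) = a + b"
proof -
  have *: "triangle (a + b) \<le> pair a b" "pair a b < triangle (Suc (a + b))"
    by (auto simp: prod_encode_def)
  then show ?thesis
    using triangle_root_bounds[of "pair a b"]
      triangle_mono[of "Suc (triangle_root (pair a b))" "a + b"]
      triangle_mono[of "Suc (a + b)" "triangle_root (pair a b)"]
    by linarith
qed

text \<open>A pair lies between two consecutive triangular numbers, so its triangular root is the
  sum of the components. Both projections thereby become terms in truncated subtraction.\<close>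

lemma pfst_eq: "pfst x = x - triangle (triangle_root x)"
  and psnd_eq: "psnd x = triangle_root x - pfst x"
proof -
  have root: "triangle_root x = pfst x + psnd x"
    using triangle_root_pair[of "pfst x" "psnd x"] by simp
  have "x = pair (pfst x) (psnd x)" by simp
  also have "\<dots> = triangle (pfst x + psnd x) + pfst x" by (simp add: prod_encode_def)
  finally show "pfst x = x - triangle (triangle_root x)" unfolding root by linarith
  show "psnd x = triangle_root x - pfst x" unfolding root by simp
qed

lemma cfun_triangle_root:
  assumes "cfun A n F"
  shows "cfun A n (\<lambda>xs. triangle_root (F xs))"
proof -
  have "cfun A (Suc (Suc n)) (\<lambda>xs. xs ! 1 + (1 - (triangle (Suc (xs ! 1)) - Suc (xs ! 0))))"
    by (intro cfun_add cfun_diff cfun_triangle cfun_Suc cfun_const cfun_proj) auto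
  from cfun_rec[OF cfun_0 this assms] show ?thesis by (simp add: triangle_root_def)
qed

section \<open>Unary computable functions, with several arguments packed by pairing\<close>

definition computable :: "(nat \<Rightarrow> bool) \<Rightarrow> (nat \<Rightarrow> nat) \<Rightarrow> bool" where
  "computable A F \<longleftrightarrow> cfun A 1 (\<lambda>xs. F (xs ! 0))"

lemma computable_iff: "computable A F \<longleftrightarrow> (\<exists>f. \<forall>x. eval A f [x] (F x))"
proof -
  have "length xs = 1 \<longleftrightarrow> (\<exists>x. xs = [x])" for xs :: "nat list"
    by (auto simp: length_Suc_conv)
  then show ?thesis unfolding computable_def cfun_def by (simp add: all_conj_distrib) (metis nth_Cons_0)
qed

named_theorems comp_intros

lemma computable_id [comp_intros]: "computable A (\<lambda>x. x)"
  unfolding computable_def by (rule cfun_proj) simp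

lemma computable_const [comp_intros]: "computable A (\<lambda>x. c)"
  unfolding computable_def by (rule cfun_const)

lemma computable_Suc [comp_intros]: "computable A F \<Longrightarrow> computable A (\<lambda>x. Suc (F x))"
  unfolding computable_def by (rule cfun_Suc)

lemma computable_orc [comp_intros]: "computable A F \<Longrightarrow> computable A (\<lambda>x. of_bool (A (F x)))"
  unfolding computable_def by (rule cfun_orc)

lemma computable_add [comp_intros]:
  "computable A F \<Longrightarrow> computable A G \<Longrightarrow> computable A (\<lambda>x. F x + G x)"
  unfolding computable_def by (rule cfun_add)

lemma computable_diff [comp_intros]:
  "computable A F \<Longrightarrow> computable A G \<Longrightarrow> computable A (\<lambda>x. F x - G x)"
  unfolding computable_def by (rule cfun_diff)

lemma cfun_pair: "cfun A n F \<Longrightarrow> cfun A n G \<Longrightarrow> cfun A n (\<lambda>xs. pair (F xs) (G xs))"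
  by (simp add: prod_encode_def cfun_add cfun_triangle)

lemma computable_pair [comp_intros]:
  "computable A F \<Longrightarrow> computable A G \<Longrightarrow> computable A (\<lambda>x. pair (F x) (G x))"
  unfolding computable_def by (rule cfun_pair)

lemma computable_pfst [comp_intros]: "computable A F \<Longrightarrow> computable A (\<lambda>x. pfst (F x))"
  unfolding computable_def pfst_eq[abs_def] by (intro cfun_diff cfun_triangle cfun_triangle_root)

lemma computable_psnd [comp_intros]: "computable A F \<Longrightarrow> computable A (\<lambda>x. psnd (F x))"
  unfolding computable_def psnd_eq[abs_def] pfst_eq[abs_def]
  by (intro cfun_diff cfun_triangle cfun_triangle_root)

lemma computable_comp:
  assumes "computable A F" "computable A G"
  shows "computable A (\<lambda>x. F (G x))"
  using cfun_comp[of A "[\<lambda>xs. G (xs ! 0)]" "\<lambda>xs. F (xs ! 0)" 1] assms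
  by (simp add: computable_def)

text \<open>As \<open>computable\<close> is unary, the step function is presented on one number
  coding the parameter, the counter and the previous value, in this order.\<close>

lemma computable_rec:
  assumes "computable A G" "computable A (\<lambda>z. H (pfst z) (pfst (psnd z)) (psnd (psnd z)))"
    "computable A B"
  shows "computable A (\<lambda>x. rec_nat (G x) (\<lambda>i y. H x i y) (B x))"
proof -
  let ?H = "\<lambda>z. H (pfst z) (pfst (psnd z)) (psnd (psnd z))"
  let ?Z = "\<lambda>zs :: nat list. pair (zs ! 2) (pair (zs ! 0) (zs ! 1))"
  have "cfun A 3 ?Z"
    by (intro cfun_pair cfun_proj) auto
  then have "cfun A 3 (\<lambda>zs. ?H (?Z zs))"
    using cfun_comp[of A "[?Z]" "\<lambda>xs. ?H (xs ! 0)" 3] assms(2)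
    by (simp add: computable_def)
  then have "cfun A (Suc (Suc 1)) (\<lambda>zs. H (zs ! 2) (zs ! 0) (zs ! 1))"
    by (simp add: numeral_3_eq_3)
  from cfun_rec[OF assms(1)[unfolded computable_def] this assms(3)[unfolded computable_def]]
  show ?thesis by (simp add: computable_def numeral_2_eq_2)
qed

lemma computable_mult [comp_intros]:
  assumes "computable A F" "computable A G"
  shows "computable A (\<lambda>x. F x * G x)"
proof -
  have "computable A (\<lambda>x. rec_nat 0 (\<lambda>i y. y + F x) (G x))"
    by (intro computable_rec comp_intros assms computable_comp[OF assms(1)])
  moreover have "rec_nat 0 (\<lambda>i y. y + a) b = a * b" for a b :: nat by (induction b) auto
  ultimately show ?thesis by simp
qed

lemma computable_prod [comp_intros]:
  assumes "computable A (\<lambda>z. F (pfst z) (psnd z))" "computable A B"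
  shows "computable A (\<lambda>x. \<Prod>i<B x. F x i)"
proof -
  have "computable A (\<lambda>x. rec_nat 1 (\<lambda>i y. y * F x i) (B x))"
  proof (intro computable_rec computable_mult computable_psnd computable_id computable_const assms(2))
    have "computable A (\<lambda>z. pair (pfst z) (pfst (psnd z)))" by (intro comp_intros)
    from computable_comp[OF assms(1) this]
    show "computable A (\<lambda>z. F (pfst z) (pfst (psnd z)))" by simp
  qed
  moreover have "rec_nat 1 (\<lambda>i y. y * F x i) b = (\<Prod>i<b. F x i)" for x b
    by (induction b) auto
  ultimately show ?thesis by simp
qed

lemma computable_pow [comp_intros]: "computable A F \<Longrightarrow> computable A (\<lambda>x. c ^ F x)"
  using computable_prod[of A "\<lambda>_ _. c" F] computable_const by simp

section \<open>Decidable predicates and unbounded search\<close>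

definition decidable :: "(nat \<Rightarrow> bool) \<Rightarrow> (nat \<Rightarrow> bool) \<Rightarrow> bool" where
  "decidable A Q \<longleftrightarrow> computable A (\<lambda>x. of_bool (Q x))"

lemma decidable_not [comp_intros]: "decidable A Q \<Longrightarrow> decidable A (\<lambda>x. \<not> Q x)"
proof -
  assume "decidable A Q"
  then have "computable A (\<lambda>x. 1 - of_bool (Q x))"
    unfolding decidable_def by (intro comp_intros)
  moreover have "1 - of_bool q = (of_bool (\<not> q) :: nat)" for q by simp
  ultimately show ?thesis unfolding decidable_def by (simp del: of_bool_not_iff)
qed

lemma decidable_conj [comp_intros]:
  "decidable A Q \<Longrightarrow> decidable A R \<Longrightarrow> decidable A (\<lambda>x. Q x \<and> R x)"
  unfolding decidable_def of_bool_conj by (rule computable_mult)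

lemma decidable_less [comp_intros]:
  assumes "computable A F" "computable A G"
  shows "decidable A (\<lambda>x. F x < G x)"
proof -
  have "of_bool (a < b) = 1 - (Suc a - b)" for a b :: nat by auto
  moreover have "computable A (\<lambda>x. 1 - (Suc (F x) - G x))" by (intro comp_intros assms)
  ultimately show ?thesis by (simp add: decidable_def)
qed

lemma decidable_eq [comp_intros]:
  assumes "computable A F" "computable A G"
  shows "decidable A (\<lambda>x. F x = G x)"
proof -
  have "decidable A (\<lambda>x. \<not> F x < G x \<and> \<not> G x < F x)"
    by (intro comp_intros assms)
  moreover have "(\<not> a < b \<and> \<not> b < a) \<longleftrightarrow> a = b" for a b :: nat by auto
  ultimately show ?thesis by simp
qed

lemma computable_if [comp_intros]:
  assumes "decidable A Q" "computable A F" "computable A G"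
  shows "computable A (\<lambda>x. if Q x then F x else G x)"
proof -
  have "computable A (\<lambda>x. of_bool (Q x) * F x + (1 - of_bool (Q x)) * G x)"
    using assms unfolding decidable_def by (intro comp_intros)
  moreover have "of_bool q * a + (1 - of_bool q) * b = (if q then a else b)" for q and a b :: nat
    by simp
  ultimately show ?thesis by simp
qed

lemma decidable_if [comp_intros]:
  assumes "decidable A Q" "decidable A F" "decidable A G"
  shows "decidable A (\<lambda>x. if Q x then F x else G x)"
proof -
  have "of_bool (if Q x then F x else G x)
      = (if Q x then of_bool (F x) else of_bool (G x) :: nat)" for x by simp
  moreover have "computable A (\<lambda>x. if Q x then of_bool (F x) else of_bool (G x))"
    using assms(2,3) unfolding decidable_def by (intro computable_if assms(1))
  ultimately show ?thesis by (simp add: decidable_def)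
qed

lemma decidable_comp: "decidable A Q \<Longrightarrow> computable A F \<Longrightarrow> decidable A (\<lambda>x. Q (F x))"
  unfolding decidable_def by (rule computable_comp)

lemma decidable_even [comp_intros]:
  assumes "computable A F" shows "decidable A (\<lambda>x. even (F x))"
proof -
  have "computable A (\<lambda>x. rec_nat 1 (\<lambda>i y. 1 - y) (F x))"
    by (intro computable_rec comp_intros assms)
  moreover have "rec_nat 1 (\<lambda>i y. 1 - y) b = (of_bool (even b) :: nat)" for b by (induction b) auto
  ultimately show ?thesis by (simp add: decidable_def)
qed

lemma computable_half [comp_intros]:
  assumes "computable A F" shows "computable A (\<lambda>x. F x div 2)"
proof -
  have "computable A (\<lambda>x. rec_nat 0 (\<lambda>i y. if even i then y else Suc y) (F x))"
    by (intro computable_rec comp_intros assms)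
  moreover have "rec_nat 0 (\<lambda>i y. if even i then y else Suc y) b = b div 2" for b
    by (induction b) auto
  ultimately show ?thesis by simp
qed

text \<open>Minimization applied to the negated test stops at the least witness. The test is total,
  so it has a value at all smaller numbers, as \<open>Mn\<close> demands.\<close>

lemma search_halts:
  assumes "decidable A (\<lambda>z. Q (pfst z) (psnd z))"
  shows "\<exists>f. \<forall>x. (\<exists>y. eval A f [x] y) \<longleftrightarrow> (\<exists>s. Q x s)"
proof -
  let ?R = "\<lambda>zs :: nat list. of_bool (\<not> Q (zs ! 1) (zs ! 0)) :: nat"
  have "computable A (\<lambda>z. of_bool (\<not> Q (pfst z) (psnd z)))"
    using decidable_not[OF assms] by (simp add: decidable_def)
  then have "cfun A 2 (\<lambda>zs. of_bool (\<not> Q (pfst (pair (zs ! 1) (zs ! 0))) (psnd (pair (zs ! 1) (zs ! 0)))))"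
    using cfun_comp[of A "[\<lambda>zs. pair (zs ! 1) (zs ! 0)]" "\<lambda>xs. of_bool (\<not> Q (pfst (xs ! 0)) (psnd (xs ! 0)))" 2]
    by (simp add: computable_def cfun_pair cfun_proj)
  then obtain g where g': "\<And>zs. length zs = 2 \<Longrightarrow> eval A g zs (?R zs)"
    unfolding cfun_def by auto
  have g: "eval A g [s, x] (of_bool (\<not> Q x s))" for s x
    using g'[of "[s, x]"] by simp
  have "(\<exists>y. eval A (Mn g) [x] y) \<longleftrightarrow> (\<exists>s. Q x s)" for x
  proof
    assume "\<exists>y. eval A (Mn g) [x] y"
    then obtain y where "eval A g [y, x] 0" by (auto elim: eval_MnE)
    from eval_deterministic[OF this g] show "\<exists>s. Q x s" by (auto split: if_splits)
  next
    assume "\<exists>s. Q x s"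
    then have s: "Q x (LEAST s. Q x s)" by (rule LeastI_ex)
    have "eval A (Mn g) [x] (LEAST s. Q x s)"
    proof (rule ev_mn)
      show "eval A g [LEAST s. Q x s, x] 0" using g[of "LEAST s. Q x s" x] s by simp
      show "\<forall>m<LEAST s. Q x s. \<exists>k. eval A g [m, x] (Suc k)"
      proof (intro allI impI)
        fix m assume "m < (LEAST s. Q x s)"
        then have "\<not> Q x m" by (rule not_less_Least)
        then show "\<exists>k. eval A g [m, x] (Suc k)" using g[of m x] by auto
      qed
    qed
    then show "\<exists>y. eval A (Mn g) [x] y" by blast
  qed
  then show ?thesis by blast
qed

section \<open>The halting set as a universal oracle\<close>

text \<open>Membership in \<open>halting_set\<close> speaks of some program with the given code;
  injectivity makes that program unique.\<close>

lemma code_inject: "code f = code g \<Longrightarrow> f = g"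
proof (induction f arbitrary: g)
  case (Comp f gs)
  then obtain f' gs' where g: "g = Comp f' gs'" by (cases g) (auto simp: prod_encode_eq)
  with Comp.prems have "code f = code f'" "map code gs = map code gs'"
    by (auto simp: prod_encode_eq list_encode_eq)
  then have "f = f'" "gs = gs'"
    using Comp.IH(1) list.inj_map_strong[of gs gs' code code] Comp.IH(2) by blast+
  with g show ?case by simp
next
  case Zero then show ?case by (cases g) (auto simp: prod_encode_eq)
next
  case Succ then show ?case by (cases g) (auto simp: prod_encode_eq)
next
  case (Proj i) then show ?case by (cases g) (auto simp: prod_encode_eq)
next
  case Orc then show ?case by (cases g) (auto simp: prod_encode_eq)
next
  case (Prec g h) then show ?case by (cases g) (auto simp: prod_encode_eq)
next
  case (Mn f) then show ?case by (cases g) (auto simp: prod_encode_eq)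
qed

lemma code_in_halting_set: "code f \<in> halting_set \<longleftrightarrow> (\<exists>y. eval no_oracle f [code f] y)"
  unfolding halting_set_def mem_Collect_eq by (metis code_inject)

section \<open>Hardwiring an input into a program\<close>

primrec const_prog :: "nat \<Rightarrow> recf" where
  "const_prog 0 = Zero"
| "const_prog (Suc n) = Comp Succ [const_prog n]"

lemma eval_const_prog: "eval A (const_prog n) xs n"
proof (induction n)
  case (Suc n)
  show ?case
    unfolding const_prog.simps by (rule ev_comp[OF _ ev_succ[of A n "[]"]]) (simp add: Suc)
qed (simp add: ev_zero)

text \<open>For e = \<open>code f\<close> this codes the program that ignores its input and runs
  \<open>f\<close> on x. It is needed because \<open>halting_set\<close> only asks about programs
  applied to their own code.\<close>

definition smn :: "nat \<Rightarrow> nat \<Rightarrow> nat" where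
  "smn e x = pair 4 (pair e (list_encode [code (const_prog x)]))"

lemma smn_halting_set: "smn (code f) x \<in> halting_set \<longleftrightarrow> (\<exists>y. eval no_oracle f [x] y)"
proof -
  let ?g = "Comp f [const_prog x]"
  have "smn (code f) x = code ?g" by (simp add: smn_def)
  then have "smn (code f) x \<in> halting_set \<longleftrightarrow> (\<exists>y. eval no_oracle ?g [code ?g] y)"
    using code_in_halting_set[of ?g] by simp
  moreover have "eval no_oracle ?g [code ?g] y \<longleftrightarrow> eval no_oracle f [x] y" for y
  proof
    assume "eval no_oracle ?g [code ?g] y"
    then obtain z where "eval no_oracle (const_prog x) [code ?g] z" "eval no_oracle f [z] y"
      by (auto elim!: eval_CompE simp: list_all2_Cons1)
    then show "eval no_oracle f [x] y"
      using eval_deterministic[OF eval_const_prog] by metis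
  next
    assume "eval no_oracle f [x] y"
    then show "eval no_oracle ?g [code ?g] y"
      by (rule ev_comp[rotated]) (simp add: eval_const_prog)
  qed
  ultimately show ?thesis by blast
qed

lemma computable_smn [comp_intros]:
  assumes "computable A F" "computable A G"
  shows "computable A (\<lambda>x. smn (F x) (G x))"
proof -
  \<comment> \<open>Here 4 is the tag of \<open>Comp\<close>, \<open>pair 1 0\<close> is the code of
    \<open>Succ\<close>, and \<open>Suc (pair y 0)\<close> is the one-element list with entry
    y.\<close>
  have "code (const_prog n) = rec_nat (pair 0 0) (\<lambda>i y. pair 4 (pair (pair 1 0) (Suc (pair y 0)))) n"
    for n by (induction n) auto
  moreover have "computable A (\<lambda>x. rec_nat (pair 0 0) (\<lambda>i y. pair 4 (pair (pair 1 0) (Suc (pair y 0)))) (G x))"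
    by (intro computable_rec comp_intros assms)
  ultimately have "computable A (\<lambda>x. code (const_prog (G x)))" by simp
  then show ?thesis unfolding smn_def list_encode.simps by (intro comp_intros assms)
qed

lemma decidable_halting:
  assumes "turing_red halting_set A" "computable A F"
  shows "decidable A (\<lambda>x. F x \<in> halting_set)"
proof -
  have "computable A (\<lambda>n. of_bool (n \<in> halting_set))"
    using assms(1) unfolding computable_iff turing_red_def of_bool_def .
  then show ?thesis unfolding decidable_def by (rule computable_comp) (rule assms(2))
qed

text \<open>A search that halts on x exactly when x is outside the halting set contradicts itself at
  its own code. This will exclude p = 0 and p = 1.\<close>

lemma halting_set_undecidable: "\<not> turing_red halting_set no_oracle"
proof
  assume *: "turing_red halting_set no_oracle"
  have "decidable no_oracle (\<lambda>z. pfst z \<notin> halting_set)"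
    by (rule decidable_not, rule decidable_halting[OF *], rule computable_pfst, rule computable_id)
  from search_halts[of no_oracle "\<lambda>x _. x \<notin> halting_set", OF this]
  obtain f where f: "\<forall>x. (\<exists>y. eval no_oracle f [x] y) \<longleftrightarrow> (\<exists>s :: nat. x \<notin> halting_set)" ..
  then show False using code_in_halting_set[of f] by simp
qed

section \<open>Semicomputable functions on strings\<close>

lemma str_code_eq_iff: "str_code \<sigma> = str_code \<tau> \<longleftrightarrow> \<sigma> = \<tau>"
proof -
  have "inj (of_bool :: bool \<Rightarrow> nat)" by (simp add: inj_def)
  then show ?thesis by (simp add: str_code_def list_encode_eq inj_map_eq_map)
qed

text \<open>List codes grow at the head while a sequence is built at its end. Storing the reversed
  string turns appending a bit into one pairing.\<close>

lemma str_code_rev_snoc: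
  "str_code (rev (\<tau> @ [b])) = Suc (pair (of_bool b) (str_code (rev \<tau>)))"
  by (simp add: str_code_def)

text \<open>Moves one entry from the remaining list, the second component, to the accumulator. The
  empty list has code 0, and there the step changes nothing.\<close>

definition rev_step :: "nat \<Rightarrow> nat" where
  "rev_step z = (if psnd z = 0 then z
     else pair (Suc (pair (if pfst (psnd z - 1) = 0 then 0 else 1) (pfst z))) (psnd (psnd z - 1)))"

text \<open>Every number is treated as the code of a bit list (nonzero entries count as 1), so that
  the programs fed with the result never see a number that codes no string.\<close>

definition rev_code :: "nat \<Rightarrow> nat" where
  "rev_code c = pfst (rec_nat (pair 0 c) (\<lambda>i. rev_step) c)"

lemma computable_rev_code [comp_intros]:
  assumes "computable A F"
  shows "computable A (\<lambda>x. rev_code (F x))"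
  unfolding rev_code_def rev_step_def by (intro computable_rec comp_intros assms)

lemma length_le_list_encode: "length xs \<le> list_encode xs"
proof (induction xs)
  case (Cons x xs)
  then show ?case using le_prod_encode_2[of "list_encode xs" x] by simp
qed simp

lemma rev_code_list_encode: "rev_code (list_encode xs) = str_code (map (\<lambda>x. x \<noteq> 0) (rev xs))"
proof -
  let ?b = "\<lambda>x :: nat. of_bool (x \<noteq> 0) :: nat"
  have "rec_nat (pair 0 (list_encode xs)) (\<lambda>i. rev_step) k
      = pair (list_encode (map ?b (rev (take k xs)))) (list_encode (drop k xs))" for k
  proof (induction k)
    case (Suc k)
    show ?case
    proof (cases "drop k xs")
      case Nil
      then show ?thesis using Suc by (simp add: rev_step_def)
    next
      case (Cons y ys)
      then have "k < length xs" by (metis drop_eq_Nil linorder_not_le list.discI)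
      moreover have "xs ! k = y" using Cons by (metis nth_via_drop)
      ultimately have "take (Suc k) xs = take k xs @ [y]" by (simp add: take_Suc_conv_app_nth)
      moreover have "drop (Suc k) xs = ys" using Cons by (metis drop_Suc list.sel(3) tl_drop)
      ultimately show ?thesis using Suc Cons by (auto simp: rev_step_def)
    qed
  qed simp
  \<comment> \<open>The loop runs as often as the value of the code. No list is longer than its
    code, and surplus steps are harmless.\<close>
  from this[of "list_encode xs"] show ?thesis
    using length_le_list_encode[of xs]
    by (simp add: rev_code_def str_code_def comp_def rev_map)
qed

lemma rev_code_str_code_rev [simp]: "rev_code (str_code (rev \<sigma>)) = str_code \<sigma>"
proof -
  have "map (\<lambda>x :: nat. x \<noteq> 0) (map of_bool \<sigma>) = \<sigma>" by (induction \<sigma>) auto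
  then show ?thesis
    unfolding str_code_def[of "rev \<sigma>"] rev_code_list_encode rev_map[symmetric] rev_rev_ident
    by simp
qed

lemma rev_code_is_str_code: "\<exists>\<sigma>. rev_code c = str_code \<sigma>"
  using rev_code_list_encode[of "list_decode c"] by auto

section \<open>Approximation from below by computable nonnegative rationals\<close>

definition rat_computable :: "(nat \<Rightarrow> real) \<Rightarrow> bool" where
  "rat_computable F \<longleftrightarrow> (\<exists>n d. computable no_oracle n \<and> computable no_oracle d
     \<and> (\<forall>x. 0 < d x \<and> F x = real (n x) / real (d x)))"

lemma rat_computable_add_scaled:
  assumes "rat_computable F" "rat_computable G"
  shows "rat_computable (\<lambda>x. F x + G x / real (Suc W))"
proof -
  obtain n d n' d' where
    c: "computable no_oracle n" "computable no_oracle d"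
      "computable no_oracle n'" "computable no_oracle d'"
    and F: "\<And>x. 0 < d x" "\<And>x. F x = real (n x) / real (d x)"
    and G: "\<And>x. 0 < d' x" "\<And>x. G x = real (n' x) / real (d' x)"
    using assms unfolding rat_computable_def by blast
  let ?n = "\<lambda>x. n x * (d' x * Suc W) + n' x * d x" and ?d = "\<lambda>x. d x * (d' x * Suc W)"
  have "computable no_oracle ?n" "computable no_oracle ?d"
    by (intro comp_intros c)+
  moreover have "0 < ?d x \<and> F x + G x / real (Suc W) = real (?n x) / real (?d x)" for x
  proof -
    have "real (d x) \<noteq> 0" "real (d' x) \<noteq> 0" "real (Suc W) \<noteq> 0"
      using F(1)[of x] G(1)[of x] by simp_all
    then show ?thesis
      using F(1)[of x] G(1)[of x] unfolding F(2) G(2) of_nat_add of_nat_mult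
      by (simp add: add_frac_eq del: of_nat_Suc)
  qed
  ultimately show ?thesis unfolding rat_computable_def by blast
qed

text \<open>A variant of \<open>left_ce\<close> suited to runs: the approximation receives the code
  of the reversed string, and its values are quotients of naturals at every number, including those
  that code no bit string.\<close>

definition lower_approximable :: "(bool list \<Rightarrow> real) \<Rightarrow> bool" where
  "lower_approximable \<Delta> \<longleftrightarrow> (\<exists>q. rat_computable (\<lambda>z. q (pfst z) (psnd z))
     \<and> (\<forall>\<sigma>. incseq (q (str_code (rev \<sigma>))) \<and> q (str_code (rev \<sigma>)) \<longlonglongrightarrow> \<Delta> \<sigma>))"

lemma lower_approximable_0: "lower_approximable (\<lambda>_. 0)"
proof -
  have "rat_computable (\<lambda>z. 0)"
    unfolding rat_computable_def
    by (rule exI[of _ "\<lambda>_. 0"], rule exI[of _ "\<lambda>_. 1"]) (simp add: computable_const)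
  then show ?thesis
    unfolding lower_approximable_def
    by (intro exI[of _ "\<lambda>_ _. 0"]) (simp add: incseq_def)
qed

lemma lower_approximable_add_scaled:
  assumes "lower_approximable \<Delta>" "lower_approximable \<delta>"
  shows "lower_approximable (\<lambda>\<sigma>. \<Delta> \<sigma> + \<delta> \<sigma> / real (Suc W))"
proof -
  obtain q r where
    q: "rat_computable (\<lambda>z. q (pfst z) (psnd z))"
      "\<And>\<sigma>. incseq (q (str_code (rev \<sigma>)))" "\<And>\<sigma>. q (str_code (rev \<sigma>)) \<longlonglongrightarrow> \<Delta> \<sigma>" and
    r: "rat_computable (\<lambda>z. r (pfst z) (psnd z))"
      "\<And>\<sigma>. incseq (r (str_code (rev \<sigma>)))" "\<And>\<sigma>. r (str_code (rev \<sigma>)) \<longlonglongrightarrow> \<delta> \<sigma>"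
    using assms unfolding lower_approximable_def by blast
  let ?q = "\<lambda>c s. q c s + r c s / real (Suc W)"
  have "rat_computable (\<lambda>z. ?q (pfst z) (psnd z))"
    using rat_computable_add_scaled[OF q(1) r(1)] .
  moreover have "incseq (?q (str_code (rev \<sigma>)))" for \<sigma>
    using q(2)[of \<sigma>] r(2)[of \<sigma>] unfolding incseq_def
    by (intro allI impI add_mono divide_right_mono) auto
  moreover have "?q (str_code (rev \<sigma>)) \<longlonglongrightarrow> \<Delta> \<sigma> + \<delta> \<sigma> / real (Suc W)" for \<sigma>
    by (intro tendsto_intros q(3) r(3)) simp
  ultimately show ?thesis unfolding lower_approximable_def by (intro exI[of _ ?q]) blast
qed

lemma left_ce_lower_approximable:
  assumes "left_ce \<delta>" "\<And>\<sigma>. 0 \<le> \<delta> \<sigma>"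
  shows "lower_approximable \<delta>"
proof -
  obtain f q where
    f: "\<And>\<sigma> s. eval no_oracle f [pair (str_code \<sigma>) s] (q \<sigma> s)" and
    q: "\<And>\<sigma>. incseq (\<lambda>s. rat_of_code (q \<sigma> s))" "\<And>\<sigma>. (\<lambda>s. rat_of_code (q \<sigma> s)) \<longlonglongrightarrow> \<delta> \<sigma>"
    using assms(1) unfolding left_ce_def by blast
  \<comment> \<open>The program \<open>f\<close> is only known to halt on codes of strings, while a
    value is wanted for every c; \<open>rev_code\<close> always supplies such a code.\<close>
  obtain \<rho> where \<rho>: "\<And>c. rev_code c = str_code (\<rho> c)"
    using rev_code_is_str_code by metis
  define v where "v c s = q (\<rho> c) s" for c s
  have v: "v (str_code (rev \<sigma>)) = q \<sigma>" for \<sigma>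
    using str_code_eq_iff[of "\<rho> (str_code (rev \<sigma>))" \<sigma>] \<rho>[of "str_code (rev \<sigma>)"] by (auto simp: v_def)
  have "computable no_oracle (\<lambda>z. pair (rev_code (pfst z)) (psnd z))"
    by (intro comp_intros)
  then obtain g where g: "\<And>z. eval no_oracle g [z] (pair (rev_code (pfst z)) (psnd z))"
    unfolding computable_iff by blast
  have "eval no_oracle (Comp f [g]) [z] (v (pfst z) (psnd z))" for z
    using g[of z] f[of "\<rho> (pfst z)" "psnd z"]
    by (intro ev_comp[where ys = "[pair (rev_code (pfst z)) (psnd z)]"]) (simp_all add: v_def \<rho>)
  then have V: "computable no_oracle (\<lambda>z. v (pfst z) (psnd z))"
    unfolding computable_iff by blast
  \<comment> \<open>Even codes stand for the nonnegative integers under \<open>int_decode\<close>.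
    Negative approximations are cut to 0, which keeps the limit because it is nonnegative.\<close>
  let ?n = "\<lambda>w. if even (pfst w) then pfst w div 2 else 0"
  have pos: "max 0 (rat_of_code w) = real (?n w) / real (Suc (psnd w))" for w
  proof (cases "even (pfst w)")
    case True
    then show ?thesis
      by (auto simp: rat_of_code_def pfst_def psnd_def int_decode_def sum_decode_def max_def
          not_le divide_less_0_iff)
  next
    case False
    then show ?thesis
      by (auto simp: rat_of_code_def pfst_def psnd_def int_decode_def sum_decode_def max_def
          field_simps)
  qed
  define r where "r c s = max 0 (rat_of_code (v c s))" for c s
  have "rat_computable (\<lambda>z. r (pfst z) (psnd z))"
    unfolding rat_computable_def r_def pos
    by (rule exI[of _ "\<lambda>z. ?n (v (pfst z) (psnd z))"],
        rule exI[of _ "\<lambda>z. Suc (psnd (v (pfst z) (psnd z)))"])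
      (intro conjI comp_intros V allI; simp)
  moreover have "incseq (r (str_code (rev \<sigma>)))" for \<sigma>
    using q(1)[of \<sigma>] unfolding incseq_def r_def v by (auto simp: max_def) (meson order_trans)+
  moreover have "r (str_code (rev \<sigma>)) \<longlonglongrightarrow> \<delta> \<sigma>" for \<sigma>
    using tendsto_max[OF tendsto_const q(2)[of \<sigma>], of 0] assms(2)[of \<sigma>]
    by (simp add: r_def[abs_def] v max_absorb2)
  ultimately show ?thesis unfolding lower_approximable_def by blast
qed

section \<open>Semidecidable questions\<close>

definition semidecidable :: "(nat \<Rightarrow> bool) \<Rightarrow> bool" where
  "semidecidable h \<longleftrightarrow> (\<exists>Q. decidable no_oracle (\<lambda>z. Q (pfst z) (psnd z)) \<and> (\<forall>x. h x \<longleftrightarrow> (\<exists>s. Q x s)))"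

lemma semidecidable_if:
  assumes "decidable no_oracle Q" "semidecidable h" "semidecidable h'"
  shows "semidecidable (\<lambda>x. if Q x then h x else h' x)"
proof -
  obtain R R' where R: "decidable no_oracle (\<lambda>z. R (pfst z) (psnd z))" "\<And>x. h x \<longleftrightarrow> (\<exists>s. R x s)"
    and R': "decidable no_oracle (\<lambda>z. R' (pfst z) (psnd z))" "\<And>x. h' x \<longleftrightarrow> (\<exists>s. R' x s)"
    using assms(2,3) unfolding semidecidable_def by auto
  have "decidable no_oracle (\<lambda>z. if Q (pfst z) then R (pfst z) (psnd z) else R' (pfst z) (psnd z))"
    by (intro decidable_if R(1) R'(1) decidable_comp[OF assms(1)] comp_intros)
  then show ?thesis
    unfolding semidecidable_def
    by (intro exI[of _ "\<lambda>x s. if Q x then R x s else R' x s"]) (simp add: R(2) R'(2))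
qed

text \<open>One number e thus describes a whole rule, and each of its answers is a single query to
  the halting set.\<close>

lemma semidecidable_halting:
  assumes "semidecidable h"
  shows "\<exists>e. \<forall>x. h x \<longleftrightarrow> smn e x \<in> halting_set"
  using assms search_halts[of no_oracle] smn_halting_set unfolding semidecidable_def by metis

text \<open>A strict excess over a bound shows at a finite stage of an approximation from below, and
  clearing denominators leaves a comparison of naturals. The fraction N / D is part of the question,
  so the test uses no oracle.\<close>

lemma semidecidable_threshold:
  assumes "lower_approximable \<Delta>" "0 < b"
  shows "\<exists>h. semidecidable h \<and> (\<forall>m \<tau> N D. 0 < D \<longrightarrow>
    (h (pair m (pair (str_code (rev \<tau>)) (pair N D)))
      \<longleftrightarrow> real a / real b * (real N / real D) < \<Delta> (\<tau> @ [False])))"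
proof -
  obtain q where
    q: "rat_computable (\<lambda>z. q (pfst z) (psnd z))"
      "\<And>\<sigma>. incseq (q (str_code (rev \<sigma>)))" "\<And>\<sigma>. q (str_code (rev \<sigma>)) \<longlonglongrightarrow> \<Delta> \<sigma>"
    using assms(1) unfolding lower_approximable_def by blast
  obtain n d where c: "computable no_oracle n" "computable no_oracle d"
    and nd: "\<And>z. 0 < d z" "\<And>z. q (pfst z) (psnd z) = real (n z) / real (d z)"
    using q(1) unfolding rat_computable_def by blast
  \<comment> \<open>Prefixing the reversed string with the bit 0 yields the code of the reversal of
    \<open>\<tau> @ [False]\<close>.\<close>
  let ?z = "\<lambda>x s. pair (Suc (pair 0 (pfst (psnd x)))) s"
  let ?Q = "\<lambda>x s. a * pfst (psnd (psnd x)) * d (?z x s) < n (?z x s) * (b * psnd (psnd (psnd x)))"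
  have "decidable no_oracle (\<lambda>z. ?Q (pfst z) (psnd z))"
    by (intro comp_intros computable_comp[OF c(1)] computable_comp[OF c(2)])
  then have "semidecidable (\<lambda>x. \<exists>s. ?Q x s)"
    unfolding semidecidable_def by (intro exI[of _ ?Q]) auto
  moreover have "(\<exists>s. ?Q (pair m (pair (str_code (rev \<tau>)) (pair N D))) s)
      \<longleftrightarrow> real a / real b * (real N / real D) < \<Delta> (\<tau> @ [False])" (is "_ \<longleftrightarrow> ?r < _")
    if "0 < D" for m \<tau> N D
  proof -
    let ?c = "str_code (rev (\<tau> @ [False]))"
    have c: "?c = Suc (pair 0 (str_code (rev \<tau>)))" unfolding str_code_rev_snoc by simp
    have "?Q (pair m (pair (str_code (rev \<tau>)) (pair N D))) s \<longleftrightarrow> ?r < q ?c s" for s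
    proof -
      have "?r < q ?c s \<longleftrightarrow> ?r < real (n (pair ?c s)) / real (d (pair ?c s))"
        using nd(2)[of "pair ?c s"] by simp
      also have "?r = real (a * N) / real (b * D)" by simp
      also have "real (a * N) / real (b * D) < real (n (pair ?c s)) / real (d (pair ?c s))
          \<longleftrightarrow> real (a * N) * real (d (pair ?c s)) < real (n (pair ?c s)) * real (b * D)"
        using assms(2) that nd(1)[of "pair ?c s"] by (simp add: divide_simps)
      also have "\<dots> \<longleftrightarrow> a * N * d (pair ?c s) < n (pair ?c s) * (b * D)"
        unfolding of_nat_mult[symmetric] of_nat_less_iff ..
      finally show ?thesis unfolding c by simp
    qed
    moreover have "(\<exists>s. ?r < q ?c s) \<longleftrightarrow> ?r < \<Delta> (\<tau> @ [False])"
    proof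
      assume "\<exists>s. ?r < q ?c s"
      then show "?r < \<Delta> (\<tau> @ [False])"
        using incseq_le[OF q(2) q(3), of "\<tau> @ [False]"] by (meson less_le_trans)
    next
      assume "?r < \<Delta> (\<tau> @ [False])"
      from order_tendstoD(1)[OF q(3) this] show "\<exists>s. ?r < q ?c s"
        by (auto simp: eventually_sequentially)
    qed
    ultimately show ?thesis by simp
  qed
  ultimately show ?thesis by blast
qed

section \<open>A rational product measure close to the Bernoulli measure\<close>

definition approx :: "real \<Rightarrow> nat \<Rightarrow> nat" where
  "approx p i = nat \<lfloor>p * 2 ^ i\<rfloor>"

text \<open>At position i the bit 0 has weight (\<open>approx p i\<close> + 1) / (2^i + 1) and the
  bit 1 has the rest. For p < 1 the added 1 keeps both weights positive, and they differ from those
  of p by an amount of order 2^-i, which is summable.\<close>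

definition num :: "real \<Rightarrow> bool list \<Rightarrow> nat" where
  "num p \<tau> = (\<Prod>i<length \<tau>. if \<tau> ! i then 2 ^ i - approx p i else Suc (approx p i))"

definition den :: "nat \<Rightarrow> nat" where
  "den m = (\<Prod>i<m. Suc (2 ^ i))"

definition nu :: "real \<Rightarrow> bool list \<Rightarrow> real" where
  "nu p \<tau> = real (num p \<tau>) / real (den (length \<tau>))"

lemma approx_Suc:
  assumes "0 \<le> p"
  shows "approx p (Suc i) = 2 * approx p i + of_bool (pbit p i)"
proof -
  let ?x = "p * 2 ^ i"
  have n: "0 \<le> \<lfloor>?x\<rfloor>" using assms by simp
  have b: "pbit p i = odd \<lfloor>2 * ?x\<rfloor>" by (simp add: pbit_def mult_ac)
  have "\<lfloor>2 * ?x\<rfloor> = 2 * \<lfloor>?x\<rfloor> \<or> \<lfloor>2 * ?x\<rfloor> = 2 * \<lfloor>?x\<rfloor> + 1" by linarith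
  then have "\<lfloor>2 * ?x\<rfloor> = 2 * \<lfloor>?x\<rfloor> + of_bool (pbit p i)" unfolding b by auto
  moreover have "approx p (Suc i) = nat \<lfloor>2 * ?x\<rfloor>" by (simp add: approx_def mult_ac)
  ultimately show ?thesis using n by (simp add: approx_def nat_add_distrib nat_mult_distrib)
qed

lemma approx_bounds:
  assumes "0 \<le> p"
  shows "real (approx p i) \<le> p * 2 ^ i" "p * 2 ^ i < real (approx p i) + 1"
proof -
  have "0 \<le> p * 2 ^ i" using assms by simp
  then show "real (approx p i) \<le> p * 2 ^ i" "p * 2 ^ i < real (approx p i) + 1"
    unfolding approx_def by linarith+
qed

lemma approx_less:
  assumes "0 \<le> p" "p < 1"
  shows "approx p i < 2 ^ i"
proof -
  have "real (approx p i) \<le> p * 2 ^ i" using approx_bounds(1)[OF assms(1)] .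
  also have "\<dots> < real (2 ^ i)" using assms(2) by simp
  finally show ?thesis unfolding of_nat_less_iff .
qed

lemma computable_approx:
  assumes "0 \<le> p" "computable (pbit p) F"
  shows "computable (pbit p) (\<lambda>x. approx p (F x))"
proof -
  have "approx p n = rec_nat (nat \<lfloor>p\<rfloor>) (\<lambda>i y. 2 * y + of_bool (pbit p i)) n" for n
  proof (induction n)
    case (Suc n)
    then show ?case by (simp add: approx_Suc[OF assms(1)])
  qed (simp add: approx_def)
  moreover have "computable (pbit p)
      (\<lambda>x. rec_nat (nat \<lfloor>p\<rfloor>) (\<lambda>i y. 2 * y + of_bool (pbit p i)) (F x))"
    by (intro computable_rec comp_intros assms(2))
  ultimately show ?thesis by simp
qed

lemma computable_den [comp_intros]: "computable A F \<Longrightarrow> computable A (\<lambda>x. den (F x))"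
  unfolding den_def by (intro comp_intros)

lemma num_Nil [simp]: "num p [] = 1"
  by (simp add: num_def)

lemma num_snoc: "num p (\<tau> @ [b]) = num p \<tau> *
    (if b then 2 ^ length \<tau> - approx p (length \<tau>) else Suc (approx p (length \<tau>)))"
  by (simp add: num_def nth_append cong: if_cong)

lemma den_pos: "0 < den m"
  by (simp add: den_def)

lemma den_Suc: "den (Suc m) = den m * Suc (2 ^ m)"
  by (simp add: den_def)

lemma nu_snoc: "nu p (\<tau> @ [b]) = nu p \<tau> * (real
    (if b then 2 ^ length \<tau> - approx p (length \<tau>) else Suc (approx p (length \<tau>)))
      / real (Suc (2 ^ length \<tau>)))"
  unfolding nu_def num_snoc length_append length_Cons list.size add_Suc_right add_0_right
    den_Suc of_nat_mult by simp

lemma nu_pos: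
  assumes "0 \<le> p" "p < 1"
  shows "0 < nu p \<tau>"
proof -
  have "0 < num p \<tau>" unfolding num_def using approx_less[OF assms] by (auto intro!: prod_pos)
  then show ?thesis using den_pos by (simp add: nu_def)
qed

lemma nu_add:
  assumes "0 \<le> p" "p < 1"
  shows "nu p (\<tau> @ [False]) + nu p (\<tau> @ [True]) = nu p \<tau>"
proof -
  let ?m = "length \<tau>"
  have "real (Suc (approx p ?m)) + real (2 ^ ?m - approx p ?m) = real (Suc (2 ^ ?m))"
    using approx_less[OF assms, of ?m] by (simp add: of_nat_diff)
  then have "real (Suc (approx p ?m)) / real (Suc (2 ^ ?m))
      + real (2 ^ ?m - approx p ?m) / real (Suc (2 ^ ?m)) = 1"
    unfolding add_divide_distrib[symmetric] by (metis divide_self of_nat_0_eq_iff nat.distinct(2))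
  then show ?thesis unfolding nu_snoc distrib_left[symmetric] if_True if_False simp_thms by simp
qed

section \<open>Comparison with the Bernoulli measure\<close>

lemma mu_str_snoc: "mu_str p (\<tau> @ [b]) = mu_str p \<tau> * (if b then 1 - p else p)"
  by (simp add: mu_str_def count0_def count1_def)

lemma mu_str_pos: "0 < p \<Longrightarrow> p < 1 \<Longrightarrow> 0 < mu_str p \<tau>"
  by (simp add: mu_str_def)

text \<open>Position i multiplies the ratio of \<open>nu\<close> to \<open>mu_str\<close> by at most
  1 + k 2^-i \<le> exp (k 2^-i), where k turns the absolute error into a relative one. The exponents
  add up to at most 2 k.\<close>

lemma nu_le_mu_str:
  assumes "0 < p" "p < 1"
  shows "\<exists>C>0. \<forall>\<tau>. nu p \<tau> \<le> C * mu_str p \<tau>"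
proof -
  define k where "k = 1 / min p (1 - p)"
  have k: "1 \<le> q * k" if "q = p \<or> q = 1 - p" for q
    using that assms by (auto simp: k_def field_simps min_def)
  have k0: "0 \<le> k" using assms by (simp add: k_def)
  have bound: "nu p \<tau> \<le> exp (k * (\<Sum>i<length \<tau>. (1 / 2) ^ i)) * mu_str p \<tau>" for \<tau>
  proof (induction \<tau> rule: rev_induct)
    case Nil
    then show ?case by (simp add: nu_def den_def mu_str_def count0_def count1_def)
  next
    case (snoc b \<tau>)
    let ?m = "length \<tau>"
    define q where "q = (if b then 1 - p else p)"
    define r where "r = real (if b then 2 ^ ?m - approx p ?m else Suc (approx p ?m))"
    have q0: "0 < q" and qk: "1 \<le> q * k" using assms k by (auto simp: q_def)
    have "r \<le> q * 2 ^ ?m + 1"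
      using approx_bounds[of p ?m] approx_less[of p ?m] assms
      by (auto simp: r_def q_def of_nat_diff algebra_simps)
    then have "r / real (Suc (2 ^ ?m)) \<le> (q * 2 ^ ?m + 1) / 2 ^ ?m"
      using q0 by (intro frac_le) auto
    also have "\<dots> = q + (1 / 2) ^ ?m" by (simp add: field_simps)
    also have "\<dots> \<le> q + q * k * (1 / 2) ^ ?m"
      using mult_right_mono[OF qk, of "(1 / 2) ^ ?m"] by simp
    also have "\<dots> = q * (1 + k * (1 / 2) ^ ?m)" by (simp add: algebra_simps)
    also have "\<dots> \<le> q * exp (k * (1 / 2) ^ ?m)"
      using q0 by (intro mult_left_mono exp_ge_add_one_self) auto
    finally have *: "r / real (Suc (2 ^ ?m)) \<le> q * exp (k * (1 / 2) ^ ?m)" .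
    have "nu p (\<tau> @ [b]) = nu p \<tau> * (r / real (Suc (2 ^ ?m)))"
      unfolding nu_snoc r_def ..
    also have "\<dots> \<le> (exp (k * (\<Sum>i<?m. (1 / 2) ^ i)) * mu_str p \<tau>) * (q * exp (k * (1 / 2) ^ ?m))"
      using snoc * mu_str_pos[OF assms, of \<tau>]
      by (intro mult_mono) (auto simp: r_def)
    also have "\<dots> = exp (k * (\<Sum>i<length (\<tau> @ [b]). (1 / 2) ^ i)) * mu_str p (\<tau> @ [b])"
      unfolding mu_str_snoc q_def[symmetric] by (simp add: exp_add distrib_left)
    finally show ?case .
  qed
  have "nu p \<tau> \<le> exp (k * 2) * mu_str p \<tau>" for \<tau>
  proof -
    have "(\<Sum>i<length \<tau>. (1 / 2 :: real) ^ i) \<le> 2"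
      by (subst sum_gp_strict) simp
    then have "exp (k * (\<Sum>i<length \<tau>. (1 / 2) ^ i)) \<le> exp (k * 2)"
      using k0 by (simp add: mult_left_mono)
    then show ?thesis
      using bound[of \<tau>] mu_str_pos[OF assms, of \<tau>] by (meson order_trans mult_right_mono less_imp_le)
  qed
  then show ?thesis by (intro exI[of _ "exp (k * 2)"]) simp
qed

section \<open>Sequences produced by a decision rule\<close>

text \<open>The next bit after \<open>\<tau>\<close> is the answer to a question that carries \<open>\<tau>\<close> together with
  the value of \<open>nu p (\<tau> @ [False])\<close>, which is all that a rule needs to know about \<open>p\<close>.\<close>

definition query :: "real \<Rightarrow> bool list \<Rightarrow> nat" where
  "query p \<tau> = pair (length \<tau>)
     (pair (str_code (rev \<tau>)) (pair (num p (\<tau> @ [False])) (den (Suc (length \<tau>)))))"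

primrec run :: "real \<Rightarrow> (nat \<Rightarrow> bool) \<Rightarrow> nat \<Rightarrow> bool list" where
  "run p h 0 = []"
| "run p h (Suc m) = run p h m @ [h (query p (run p h m))]"

lemma length_run [simp]: "length (run p h m) = m"
  by (induction m) auto

text \<open>The question asked after m bits has first component m, so the first \<open>B\<close>
  bits depend only on the answers at levels below \<open>B\<close>.\<close>

lemma run_cong:
  assumes "\<And>x. pfst x < B \<Longrightarrow> h x = h' x" "m \<le> B"
  shows "run p h m = run p h' m"
  using assms(2) by (induction m) (auto simp: query_def assms(1))

text \<open>Every bit costs one query to the halting set, which the digits of p can answer. One
  program serves all indices and lengths, including indices of no intended rule.\<close>

lemma computable_run:
  assumes "0 \<le> p" "turing_red halting_set (pbit p)"
    "computable (pbit p) E" "computable (pbit p) L"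
  shows "computable (pbit p) (\<lambda>x. str_code (run p (\<lambda>z. smn (E x) z \<in> halting_set) (L x)))"
proof -
  \<comment> \<open>The state z pairs the code of the reversed string with its \<open>num\<close>,
    which is enough to form the next question at level i.\<close>
  let ?q = "\<lambda>i z. pair i (pair (pfst z) (pair (psnd z * Suc (approx p i)) (den (Suc i))))"
  let ?step = "\<lambda>e i z. if smn e (?q i z) \<in> halting_set
    then pair (Suc (pair 1 (pfst z))) (psnd z * (2 ^ i - approx p i))
    else pair (Suc (pair 0 (pfst z))) (psnd z * Suc (approx p i))"
  let ?run = "\<lambda>e. run p (\<lambda>z. smn e z \<in> halting_set)"
  have *: "rec_nat (pair 0 1) (?step e) m = pair (str_code (rev (?run e m))) (num p (?run e m))"
    for e m
  proof (induction m)
    case 0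
    then show ?case by (simp add: str_code_def)
  next
    case (Suc m)
    have "?q m (pair (str_code (rev (?run e m))) (num p (?run e m))) = query p (?run e m)"
      unfolding query_def pfst_pair psnd_pair num_snoc by simp
    then show ?case
      unfolding nat.rec(2) Suc run.simps str_code_rev_snoc num_snoc length_run
      by (simp del: mult_Suc_right)
  qed
  have "computable (pbit p) (\<lambda>x. rec_nat (pair 0 1) (\<lambda>i z. ?step (E x) i z) (L x))"
    by (intro computable_rec computable_if decidable_halting[OF assms(2)] comp_intros
        computable_approx[OF assms(1)] computable_comp[OF assms(3)] assms(4))
  then have "computable (pbit p) (\<lambda>x. rev_code (pfst (rec_nat (pair 0 1) (\<lambda>i z. ?step (E x) i z) (L x))))"
    by (intro comp_intros)
  then show ?thesis unfolding * by simp
qed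

section \<open>Cylinder measures and the Martin-Loef test\<close>

lemma emeasure_bern_cyl:
  assumes "0 \<le> p" "p \<le> 1"
  shows "cyl {\<sigma>} \<in> sets (bern p)"
    and "emeasure (bern p) (cyl {\<sigma>}) \<le> ennreal (max p (1 - p) ^ length \<sigma>)"
proof -
  let ?B = "measure_pmf (bernoulli_pmf (1 - p))"
  have eq: "cyl {\<sigma>} = prod_emb UNIV (\<lambda>_. ?B) {..<length \<sigma>} (PiE {..<length \<sigma>} (\<lambda>i. {\<sigma> ! i}))"
  proof (rule set_eqI)
    fix y
    have "map y [0..<length \<sigma>] = \<sigma> \<longleftrightarrow> (\<forall>i<length \<sigma>. y i = \<sigma> ! i)"
      by (subst list_eq_iff_nth_eq) simp
    then have "y \<in> cyl {\<sigma>} \<longleftrightarrow> (\<forall>i<length \<sigma>. y i = \<sigma> ! i)"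
      by (simp add: cyl_def prefix_def)
    then show "y \<in> cyl {\<sigma>} \<longleftrightarrow> y \<in> prod_emb UNIV (\<lambda>_. ?B) {..<length \<sigma>} (PiE {..<length \<sigma>} (\<lambda>i. {\<sigma> ! i}))"
      by (simp add: prod_emb_iff restrict_PiE_iff extensional_UNIV Pi_iff Ball_def)
  qed
  show "cyl {\<sigma>} \<in> sets (bern p)"
    unfolding eq bern_def by (rule sets_PiM_I) auto
  have "emeasure (bern p) (cyl {\<sigma>}) = (\<Prod>i<length \<sigma>. emeasure ?B {\<sigma> ! i})"
    unfolding eq bern_def by (rule emeasure_PiM_emb) (auto intro: measure_pmf.prob_space_axioms)
  also have "\<dots> \<le> (\<Prod>i<length \<sigma>. ennreal (max p (1 - p)))"
  proof (intro prod_mono_ennreal)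
    fix i
    have "pmf (bernoulli_pmf (1 - p)) b \<le> max p (1 - p)" for b
      using assms by (cases b) auto
    then show "emeasure ?B {\<sigma> ! i} \<le> ennreal (max p (1 - p))"
      unfolding emeasure_pmf_single by (rule ennreal_leI)
  qed
  also have "\<dots> = ennreal (max p (1 - p) ^ length \<sigma>)"
    using assms by (simp add: ennreal_power)
  finally show "emeasure (bern p) (cyl {\<sigma>}) \<le> ennreal (max p (1 - p) ^ length \<sigma>)" .
qed

text \<open>With M = \<open>max p (1 - p)\<close> < 1 and M^K < 1/2, the string obtained from e has
  measure at most 2^-(n + 1 + e). Summing over all e gives 2^-n, and searching for e enumerates the
  test.\<close>

lemma not_MLR_if_run:
  assumes p: "0 < p" "p < 1" and red: "turing_red halting_set (pbit p)"
  shows "\<exists>K. \<forall>y. (\<forall>n. \<exists>e. prefix y (K * Suc (n + e))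
      = run p (\<lambda>x. smn e x \<in> halting_set) (K * Suc (n + e))) \<longrightarrow> y \<notin> MLR p"
proof -
  define M where "M = max p (1 - p)"
  have M: "0 \<le> M" "M < 1" using p by (auto simp: M_def)
  obtain K where K: "M ^ K < 1 / 2"
    using real_arch_pow_inv[of "1 / 2" M] M by auto
  define S where "S n e = run p (\<lambda>x. smn e x \<in> halting_set) (K * Suc (n + e))" for n e
  define U where "U n \<sigma> \<longleftrightarrow> (\<exists>e. \<sigma> = S n e)" for n \<sigma>
  have "mlr_test p U"
    unfolding mlr_test_def
  proof (intro conjI allI)
    let ?Q = "\<lambda>x e. str_code (S (pfst x) e) = psnd x"
    have "computable (pbit p) (\<lambda>z. str_code (S (pfst (pfst z)) (psnd z)))"
      unfolding S_def using p by (intro computable_run red comp_intros) simp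
    then have "decidable (pbit p) (\<lambda>z. ?Q (pfst z) (psnd z))"
      by (intro decidable_eq comp_intros)
    then have "ce_in (pbit p) (\<lambda>x. \<exists>e. ?Q x e)"
      unfolding ce_in_def using search_halts[of "pbit p" ?Q] by metis
    moreover have "U n \<sigma> \<longleftrightarrow> (\<exists>e. ?Q (pair n (str_code \<sigma>)) e)" for n \<sigma>
      by (auto simp: U_def str_code_eq_iff)
    ultimately show "\<exists>R. ce_in (pbit p) R \<and> (\<forall>n \<sigma>. U n \<sigma> \<longleftrightarrow> R (pair n (str_code \<sigma>)))"
      by (intro exI[of _ "\<lambda>x. \<exists>e. ?Q x e"]) simp
    fix n
    have "cyl {\<sigma>. U n \<sigma>} = (\<Union>e. cyl {S n e})"
      by (auto simp: cyl_def U_def)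
    moreover have "range (\<lambda>e. cyl {S n e}) \<subseteq> sets (bern p)"
      using emeasure_bern_cyl(1)[of p] p by auto
    ultimately have "emeasure (bern p) (cyl {\<sigma>. U n \<sigma>}) \<le> (\<Sum>e. emeasure (bern p) (cyl {S n e}))"
      using emeasure_subadditive_countably[of "\<lambda>e. cyl {S n e}" "bern p"] by simp
    also have "\<dots> \<le> (\<Sum>e. ennreal ((1 / 2) ^ Suc n * (1 / 2) ^ e))"
    proof (intro suminf_le summableI)
      fix e
      have "emeasure (bern p) (cyl {S n e}) \<le> ennreal (M ^ (K * Suc (n + e)))"
        using emeasure_bern_cyl(2)[of p "S n e"] p by (simp add: M_def S_def)
      also have "M ^ (K * Suc (n + e)) \<le> (1 / 2) ^ Suc (n + e)"
        unfolding power_mult using K M by (intro power_mono) auto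
      finally show "emeasure (bern p) (cyl {S n e}) \<le> ennreal ((1 / 2) ^ Suc n * (1 / 2) ^ e)"
        by (simp add: power_add ennreal_leI)
    qed
    also have "\<dots> = ennreal ((1 / 2) ^ n)"
    proof (rule suminf_ennreal_eq)
      show "(\<lambda>e. (1 / 2) ^ Suc n * (1 / 2) ^ e) sums ((1 / 2 :: real) ^ n)"
        using sums_mult[OF geometric_sums[of "1 / 2 :: real"], of "(1 / 2) ^ Suc n"] by simp
    qed simp
    finally show "emeasure (bern p) (cyl {\<sigma>. U n \<sigma>}) \<le> ennreal ((1 / 2) ^ n)" .
  qed
  moreover have "y \<in> cyl {\<sigma>. U n \<sigma>}" if y: "\<forall>n. \<exists>e. prefix y (K * Suc (n + e)) = S n e" for y n
  proof -
    obtain e where "prefix y (K * Suc (n + e)) = S n e" using y by blast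
    then show ?thesis by (auto simp: cyl_def U_def S_def intro!: exI[of _ "S n e"])
  qed
  ultimately show ?thesis unfolding MLR_def S_def by blast
qed

section \<open>Keeping supermartingales bounded\<close>

text \<open>A semimeasure up to normalisation, so that adding a scaled summand stays within the
  class.\<close>

definition submeasure :: "(bool list \<Rightarrow> real) \<Rightarrow> bool" where
  "submeasure \<Delta> \<longleftrightarrow> (\<forall>\<sigma>. 0 \<le> \<Delta> \<sigma> \<and> \<Delta> (\<sigma> @ [False]) + \<Delta> (\<sigma> @ [True]) \<le> \<Delta> \<sigma>)"

lemma submeasure_add_scaled:
  assumes "submeasure \<Delta>" "submeasure \<delta>"
  shows "submeasure (\<lambda>\<sigma>. \<Delta> \<sigma> + \<delta> \<sigma> / real (Suc W))"
  unfolding submeasure_def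
proof (intro allI conjI)
  fix \<sigma>
  have "\<delta> (\<sigma> @ [False]) / real (Suc W) + \<delta> (\<sigma> @ [True]) / real (Suc W) \<le> \<delta> \<sigma> / real (Suc W)"
    unfolding add_divide_distrib[symmetric] using assms(2) unfolding submeasure_def
    by (intro divide_right_mono) auto
  moreover have "\<Delta> (\<sigma> @ [False]) + \<Delta> (\<sigma> @ [True]) \<le> \<Delta> \<sigma>"
    using assms(1) unfolding submeasure_def by blast
  ultimately show "\<Delta> (\<sigma> @ [False]) + \<delta> (\<sigma> @ [False]) / real (Suc W)
      + (\<Delta> (\<sigma> @ [True]) + \<delta> (\<sigma> @ [True]) / real (Suc W)) \<le> \<Delta> \<sigma> + \<delta> \<sigma> / real (Suc W)"
    by linarith
  show "0 \<le> \<Delta> \<sigma> + \<delta> \<sigma> / real (Suc W)"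
    using assms unfolding submeasure_def by simp
qed

text \<open>The thresholds \<open>2 - 1 / (n + 1)\<close> increase but stay below 2, which leaves room for a further
  summand at every stage.\<close>

definition thr :: "nat \<Rightarrow> real" where
  "thr n = real (2 * n + 1) / real (n + 1)"

lemma thr_less_Suc: "thr n < thr (Suc n)" and thr_less_2: "thr n < 2"
  by (simp_all add: thr_def field_simps)

text \<open>The bound starts at length \<open>B\<close> because the newest summand is scaled to fit
  there; shorter prefixes may violate it.\<close>

definition controls :: "real \<Rightarrow> nat \<Rightarrow> (nat \<Rightarrow> bool) \<Rightarrow> (bool list \<Rightarrow> real) \<Rightarrow> nat \<Rightarrow> bool" where
  "controls p n h \<Delta> B \<longleftrightarrow> semidecidable h \<and> lower_approximable \<Delta> \<and> submeasure \<Delta>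
     \<and> (\<forall>m\<ge>B. \<Delta> (run p h m) \<le> thr n * nu p (run p h m))"

text \<open>If \<open>\<Delta> (\<tau>0)\<close> exceeds its bound then \<open>\<Delta> (\<tau>1)\<close> does not, by additivity of \<open>nu\<close>.
  Hence one semidecidable question decides the next bit.\<close>

lemma controls_extend:
  assumes p: "0 \<le> p" "p < 1"
    and h: "semidecidable h" and \<Delta>: "lower_approximable \<Delta>" "submeasure \<Delta>"
    and start: "\<Delta> (run p h B) \<le> thr n * nu p (run p h B)"
  shows "\<exists>h'. controls p n h' \<Delta> B \<and> (\<forall>m\<le>B. run p h' m = run p h m)"
proof -
  \<comment> \<open>The threshold \<open>thr n\<close> enters as the quotient of the naturals 2 n +
    1 and n + 1.\<close>
  obtain g where g: "semidecidable g"
    "\<And>m \<tau> N D. 0 < D \<Longrightarrow> g (pair m (pair (str_code (rev \<tau>)) (pair N D)))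
      \<longleftrightarrow> thr n * (real N / real D) < \<Delta> (\<tau> @ [False])"
    using semidecidable_threshold[OF \<Delta>(1), of "n + 1" "2 * n + 1"] unfolding thr_def by auto
  have g: "semidecidable g" "g (query p \<tau>) \<longleftrightarrow> thr n * nu p (\<tau> @ [False]) < \<Delta> (\<tau> @ [False])"
    for \<tau> using g(1) g(2)[OF den_pos] by (simp_all add: query_def nu_def)
  \<comment> \<open>Old answers are kept below level \<open>B\<close>, so the first \<open>B\<close>
    bits survive; from there on the threshold question decides.\<close>
  define h' where "h' = (\<lambda>x. if pfst x < B then h x else g x)"
  have "semidecidable h'"
    unfolding h'_def by (intro semidecidable_if h g(1) comp_intros)
  moreover have run: "run p h' m = run p h m" if "m \<le> B" for m
    using that by (intro run_cong[of B]) (auto simp: h'_def)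
  moreover have "\<Delta> (run p h' m) \<le> thr n * nu p (run p h' m)" if "B \<le> m" for m
    using that
  proof (induction m rule: dec_induct)
    case base
    then show ?case using start run by simp
  next
    case (step m)
    let ?\<tau> = "run p h' m"
    have "h' (query p ?\<tau>) = g (query p ?\<tau>)"
      using step(1) by (simp add: h'_def query_def)
    moreover have "\<Delta> (?\<tau> @ [False]) + \<Delta> (?\<tau> @ [True]) \<le> \<Delta> ?\<tau>"
      using \<Delta>(2) unfolding submeasure_def by blast
    moreover have "thr n * nu p ?\<tau> = thr n * nu p (?\<tau> @ [False]) + thr n * nu p (?\<tau> @ [True])"
      unfolding nu_add[OF p, of ?\<tau>, symmetric] by (rule distrib_left)
    ultimately show ?case
      using step(3) g(2)[of ?\<tau>] by (cases "g (query p ?\<tau>)") auto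
  qed
  ultimately show ?thesis unfolding controls_def using \<Delta> by blast
qed

text \<open>Raising the threshold from \<open>thr n\<close> to \<open>thr (Suc n)\<close> opens a
  gap \<epsilon> > 0 at the prefix of length \<open>B'\<close>. Dividing \<delta> by a large enough
  number makes it fit into that gap.\<close>

lemma controls_step:
  assumes p: "0 \<le> p" "p < 1" and c: "controls p n h \<Delta> B" and "B \<le> B'"
    and \<delta>: "lower_approximable \<delta>" "submeasure \<delta>"
  shows "\<exists>h' \<Delta>' W. controls p (Suc n) h' \<Delta>' B' \<and> (\<forall>m\<le>B'. run p h' m = run p h m)
    \<and> (\<forall>\<sigma>. \<Delta> \<sigma> \<le> \<Delta>' \<sigma> \<and> \<delta> \<sigma> \<le> real W * \<Delta>' \<sigma>)"
proof -
  let ?\<tau> = "run p h B'"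
  define \<epsilon> where "\<epsilon> = (thr (Suc n) - thr n) * nu p ?\<tau>"
  have "0 < \<epsilon>" unfolding \<epsilon>_def using thr_less_Suc nu_pos[OF p] by simp
  obtain W where "\<delta> ?\<tau> / \<epsilon> < real W" using reals_Archimedean2 by blast
  then have "\<delta> ?\<tau> / \<epsilon> \<le> real (Suc W)" by simp
  then have W: "\<delta> ?\<tau> / real (Suc W) \<le> \<epsilon>" using \<open>0 < \<epsilon>\<close> by (simp add: field_simps)
  define \<Delta>' where "\<Delta>' = (\<lambda>\<sigma>. \<Delta> \<sigma> + \<delta> \<sigma> / real (Suc W))"
  have nonneg: "0 \<le> \<Delta> \<sigma>" "0 \<le> \<delta> \<sigma>" for \<sigma>
    using c \<delta>(2) unfolding controls_def submeasure_def by auto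
  have "\<Delta> ?\<tau> \<le> thr n * nu p ?\<tau>"
    using c \<open>B \<le> B'\<close> unfolding controls_def by blast
  with W have "\<Delta>' ?\<tau> \<le> thr (Suc n) * nu p ?\<tau>"
    unfolding \<Delta>'_def \<epsilon>_def left_diff_distrib by linarith
  moreover have "lower_approximable \<Delta>'" "submeasure \<Delta>'" "semidecidable h"
    using c \<delta> unfolding \<Delta>'_def controls_def
    by (blast intro: lower_approximable_add_scaled submeasure_add_scaled)+
  ultimately obtain h' where
    "controls p (Suc n) h' \<Delta>' B'" "\<forall>m\<le>B'. run p h' m = run p h m"
    using controls_extend[OF p] by blast
  moreover have "\<Delta> \<sigma> \<le> \<Delta>' \<sigma>" for \<sigma>
    using nonneg by (simp add: \<Delta>'_def)
  moreover have "\<delta> \<sigma> \<le> real (Suc W) * \<Delta>' \<sigma>" for \<sigma>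
    using nonneg unfolding \<Delta>'_def distrib_left by simp
  ultimately show ?thesis by blast
qed

section \<open>The sequence that resists all left-c.e. semimeasures\<close>

lemma semidecidable_False: "semidecidable (\<lambda>_. False)"
  unfolding semidecidable_def
  by (intro exI[of _ "\<lambda>_ _. False"]) (simp add: decidable_def computable_const)

text \<open>A program for the approximations determines their limit, so choosing one program for
  each function gives an injection into codes.\<close>

lemma countable_left_ce: "countable {\<delta>. left_ce \<delta>}"
proof -
  have "\<exists>f. \<exists>q. (\<forall>\<sigma> s. eval no_oracle f [pair (str_code \<sigma>) s] (q \<sigma> s))
       \<and> (\<forall>\<sigma>. (\<lambda>s. rat_of_code (q \<sigma> s)) \<longlonglongrightarrow> \<delta> \<sigma>)" if "left_ce \<delta>" for \<delta>
    using that unfolding left_ce_def by blast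
  then obtain F where F: "\<And>\<delta>. left_ce \<delta> \<Longrightarrow>
      \<exists>q. (\<forall>\<sigma> s. eval no_oracle (F \<delta>) [pair (str_code \<sigma>) s] (q \<sigma> s))
       \<and> (\<forall>\<sigma>. (\<lambda>s. rat_of_code (q \<sigma> s)) \<longlonglongrightarrow> \<delta> \<sigma>)"
    by metis
  have "inj_on (\<lambda>\<delta>. code (F \<delta>)) {\<delta>. left_ce \<delta>}"
  proof (rule inj_onI, unfold mem_Collect_eq)
    fix \<delta> \<delta>' assume l: "left_ce \<delta>" "left_ce \<delta>'" and "code (F \<delta>) = code (F \<delta>')"
    then have eq: "F \<delta> = F \<delta>'" by (intro code_inject)
    from F[OF l(1)] obtain q where
      q: "\<And>\<sigma> s. eval no_oracle (F \<delta>) [pair (str_code \<sigma>) s] (q \<sigma> s)"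
        "\<And>\<sigma>. (\<lambda>s. rat_of_code (q \<sigma> s)) \<longlonglongrightarrow> \<delta> \<sigma>" by blast
    from F[OF l(2)] obtain q' where
      q': "\<And>\<sigma> s. eval no_oracle (F \<delta>) [pair (str_code \<sigma>) s] (q' \<sigma> s)"
        "\<And>\<sigma>. (\<lambda>s. rat_of_code (q' \<sigma> s)) \<longlonglongrightarrow> \<delta>' \<sigma>" unfolding eq by blast
    have "q = q'" by (intro ext eval_deterministic[OF q(1) q'(1)])
    then show "\<delta> = \<delta>'" by (intro ext LIMSEQ_unique[OF q(2)]) (simp add: q'(2))
  qed
  then show ?thesis by (rule countableI)
qed

text \<open>For p = 1 the number \<lfloor>2^(n+1)\<rfloor> is even, so all digits after the point
  vanish, as they do for p = 0.\<close>

lemma pbit_integer: "pbit 0 = no_oracle" "pbit 1 = no_oracle"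
proof -
  show "pbit 0 = no_oracle" by (simp add: pbit_def no_oracle_def fun_eq_iff)
  have "\<lfloor>2 ^ Suc n :: real\<rfloor> = 2 ^ Suc n" for n
    by (metis floor_of_int of_int_numeral of_int_power)
  then show "pbit 1 = no_oracle" by (simp add: pbit_def no_oracle_def fun_eq_iff del: power_Suc)
qed

lemma controlling_sequence:
  fixes \<delta> :: "nat \<Rightarrow> bool list \<Rightarrow> real"
  assumes p: "0 \<le> p" "p < 1" and \<delta>: "\<And>n. lower_approximable (\<delta> n)" "\<And>n. submeasure (\<delta> n)"
  shows "\<exists>y. (\<forall>n. \<exists>e. prefix y (K * Suc (n + e))
      = run p (\<lambda>x. smn e x \<in> halting_set) (K * Suc (n + e)))
    \<and> (\<forall>i. \<exists>W N. \<forall>m>N. \<delta> i (prefix y m) \<le> real W * nu p (prefix y m))"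
proof -
  \<comment> \<open>A state holds the current rule, the weighted sum it controls, the length from
    which it does so, and an index of the rule.\<close>
  let ?P = "\<lambda>n (h, \<Delta>, B, e). controls p n h \<Delta> B \<and> (\<forall>x. h x \<longleftrightarrow> smn e x \<in> halting_set)"
  let ?R = "\<lambda>n (h, \<Delta>, B, e) (h', \<Delta>', B', e'). B < B' \<and> K * Suc (n + e) \<le> B'
    \<and> (\<forall>m\<le>B'. run p h' m = run p h m)
    \<and> (\<exists>W. \<forall>\<sigma>. \<Delta> \<sigma> \<le> \<Delta>' \<sigma> \<and> \<delta> n \<sigma> \<le> real W * \<Delta>' \<sigma>)"
  have "\<exists>f. \<forall>n. ?P n (f n) \<and> ?R n (f n) (f (Suc n))"
  proof (rule dependent_nat_choice)
    obtain e where "\<forall>x. False \<longleftrightarrow> smn e x \<in> halting_set"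
      using semidecidable_halting[OF semidecidable_False] by blast
    moreover have "0 \<le> thr 0 * nu p (run p (\<lambda>_. False) m)" for m
      using nu_pos[OF p] by (simp add: thr_def less_imp_le)
    then have "controls p 0 (\<lambda>_. False) (\<lambda>_. 0) 0"
      unfolding controls_def
      by (simp add: semidecidable_False lower_approximable_0 submeasure_def)
    ultimately have "?P 0 (\<lambda>_. False, \<lambda>_. 0, 0, e)" by simp
    then show "\<exists>s. ?P 0 s" by blast
  next
    fix s n assume "?P n s"
    moreover obtain h \<Delta> B e where s: "s = (h, \<Delta>, B, e)" by (cases s)
    ultimately have c: "controls p n h \<Delta> B" by simp
    \<comment> \<open>The index e is fixed before \<open>B'\<close> is chosen, so the length tested
      at stage n may depend on e and still lie in the part that later rules preserve. The
      \<open>Suc\<close> makes the lengths strictly increase.\<close>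
    define B' where "B' = Suc (max B (K * Suc (n + e)))"
    have "B \<le> B'" by (simp add: B'_def)
    from controls_step[OF p c this \<delta>(1)[of n] \<delta>(2)[of n]] obtain h' \<Delta>' W where
      step: "controls p (Suc n) h' \<Delta>' B'" "\<forall>m\<le>B'. run p h' m = run p h m"
        "\<forall>\<sigma>. \<Delta> \<sigma> \<le> \<Delta>' \<sigma> \<and> \<delta> n \<sigma> \<le> real W * \<Delta>' \<sigma>"
      by blast
    obtain e' where "\<forall>x. h' x \<longleftrightarrow> smn e' x \<in> halting_set"
      using semidecidable_halting step(1) unfolding controls_def by blast
    with step have "?P (Suc n) (h', \<Delta>', B', e') \<and> ?R n s (h', \<Delta>', B', e')"
      unfolding s by (auto simp: B'_def)
    then show "\<exists>s'. ?P (Suc n) s' \<and> ?R n s s'" by blast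
  qed
  then obtain f where f: "\<forall>n. ?P n (f n) \<and> ?R n (f n) (f (Suc n))" ..
  define h where "h n = fst (f n)" for n
  define \<Delta> where "\<Delta> n = fst (snd (f n))" for n
  define B where "B n = fst (snd (snd (f n)))" for n
  define e where "e n = snd (snd (snd (f n)))" for n
  have f_eq: "f n = (h n, \<Delta> n, B n, e n)" for n
    by (simp add: h_def \<Delta>_def B_def e_def)
  have controls: "controls p n (h n) (\<Delta> n) (B n)" and h_e: "h n = (\<lambda>x. smn (e n) x \<in> halting_set)" for n
    using f[THEN spec, of n] unfolding f_eq by auto
  have B: "B n < B (Suc n)" and K: "K * Suc (n + e n) \<le> B (Suc n)"
    and run: "m \<le> B (Suc n) \<Longrightarrow> run p (h (Suc n)) m = run p (h n) m"
    and \<Delta>: "\<exists>W. \<forall>\<sigma>. \<Delta> n \<sigma> \<le> \<Delta> (Suc n) \<sigma> \<and> \<delta> n \<sigma> \<le> real W * \<Delta> (Suc n) \<sigma>" for n m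
    using f[THEN spec, of n] unfolding f_eq by auto
  have B_mono: "strict_mono B" using B by (simp add: strict_mono_Suc_iff)
  \<comment> \<open>Rule k is final up to length \<open>B (Suc k)\<close>: all later rules produce
    the same bits there.\<close>
  have run_eq: "run p (h l) m = run p (h k) m" if "k \<le> l" "m \<le> B (Suc k)" for k l m
    using that(1)
  proof (induction l rule: dec_induct)
    case (step l)
    have "B (Suc k) \<le> B (Suc l)"
      using step(1) B_mono by (simp add: strict_mono_less_eq)
    then show ?case using run[of m l] step(3) that(2) by simp
  qed simp
  \<comment> \<open>Bit m is read at stage m, where it is already final because
    \<open>Suc m \<le> B (Suc m)\<close>.\<close>
  define y where "y m = h m (query p (run p (h m) m))" for m
  have y: "prefix y m = run p (h k) m" if "m \<le> B (Suc k)" for k m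
    using that
  proof (induction m)
    case 0
    then show ?case by (simp add: prefix_def)
  next
    case (Suc m)
    have "Suc m \<le> B (Suc m)" using strict_mono_imp_increasing[OF B_mono] .
    then have "run p (h m) (Suc m) = run p (h k) (Suc m)"
      using run_eq[of m k "Suc m"] run_eq[of k m "Suc m"] Suc.prems by (cases "m \<le> k") auto
    then have "y m = h k (query p (run p (h k) m))"
      unfolding y_def run.simps(2) append1_eq_conv by blast
    with Suc show ?case by (simp add: prefix_def)
  qed
  have "\<exists>e. prefix y (K * Suc (n + e)) = run p (\<lambda>x. smn e x \<in> halting_set) (K * Suc (n + e))" for n
    using y[OF K[of n]] unfolding h_e by blast
  moreover have "\<exists>W N. \<forall>m>N. \<delta> i (prefix y m) \<le> real W * nu p (prefix y m)" for i
  proof -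
    obtain W where W: "\<And>\<sigma>. \<delta> i \<sigma> \<le> real W * \<Delta> (Suc i) \<sigma>" using \<Delta>[of i] by blast
    have "\<delta> i (prefix y m) \<le> real (W * 2) * nu p (prefix y m)" if m: "B (Suc i) < m" for m
    proof -
      let ?\<sigma> = "prefix y m"
      \<comment> \<open>This stage satisfies \<open>B k < m \<le> B (Suc k)\<close>: the prefix is
        the one produced by rule k, and the bound of stage k is already in force. Since k exceeds i,
        \<open>\<Delta> k\<close> dominates \<open>\<Delta> (Suc i)\<close> and hence a multiple of
        \<open>\<delta> i\<close>.\<close>
      define k where "k = (LEAST k. m \<le> B (Suc k))"
      have "m \<le> B (Suc m)" using strict_mono_imp_increasing[OF B_mono, of "Suc m"] by simp
      then have k: "m \<le> B (Suc k)" unfolding k_def by (rule LeastI)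
      have ik: "Suc i \<le> k"
      proof (rule ccontr)
        assume "\<not> Suc i \<le> k"
        then have "B (Suc k) \<le> B (Suc i)" using B_mono by (simp add: strict_mono_less_eq)
        with k m show False by simp
      qed
      then obtain k' where k': "k = Suc k'" by (cases k) auto
      have "\<not> m \<le> B (Suc k')" using not_less_Least[of k' "\<lambda>k. m \<le> B (Suc k)"] k' k_def by simp
      then have "\<Delta> k ?\<sigma> \<le> thr k * nu p ?\<sigma>"
        using controls[of k] unfolding y[OF k] controls_def k' by simp
      also have "\<dots> \<le> 2 * nu p ?\<sigma>"
        using thr_less_2[of k] nu_pos[OF p, of ?\<sigma>] by (intro mult_right_mono) auto
      finally have "\<Delta> k ?\<sigma> \<le> 2 * nu p ?\<sigma>" .
      moreover have "\<Delta> (Suc i) ?\<sigma> \<le> \<Delta> k ?\<sigma>"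
        using lift_Suc_mono_le[of "\<lambda>n. \<Delta> n ?\<sigma>" "Suc i" k] \<Delta> ik by blast
      ultimately have "real W * \<Delta> (Suc i) ?\<sigma> \<le> real W * (2 * nu p ?\<sigma>)"
        by (intro mult_left_mono) auto
      with W[of ?\<sigma>] show ?thesis by simp
    qed
    then show ?thesis by blast
  qed
  ultimately show ?thesis by blast
qed

theorem mainTheorem18:
  fixes p :: real
  assumes "0 \<le> p" and "p \<le> 1"
    and "turing_red halting_set (pbit p)"
  shows "\<exists>y. y \<notin> MLR p \<and>
           (\<forall>\<delta>. semimeasure \<delta> \<and> left_ce \<delta> \<longrightarrow> \<not> succeeds (blind_mart p \<delta>) y)"
proof -
  have "p \<noteq> 0" "p \<noteq> 1"
    using assms(3) halting_set_undecidable pbit_integer by auto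
  with assms have p: "0 < p" "p < 1" "0 \<le> p" by auto
  \<comment> \<open>The zero function makes the set nonempty, so that \<open>from_nat_into\<close>
    enumerates exactly its elements.\<close>
  let ?G = "insert (\<lambda>_. 0) {\<delta>. semimeasure \<delta> \<and> left_ce \<delta>}"
  have "countable ?G"
    using countable_left_ce by (auto intro: countable_subset)
  then have range: "range (from_nat_into ?G) = ?G" by (intro range_from_nat_into) auto
  have G: "lower_approximable \<delta> \<and> submeasure \<delta>" if "\<delta> \<in> ?G" for \<delta>
    using that lower_approximable_0 left_ce_lower_approximable[of \<delta>]
    by (auto simp: submeasure_def semimeasure_def)
  have "from_nat_into ?G n \<in> ?G" for n using range by blast
  from G[OF this] have G': "lower_approximable (from_nat_into ?G n)" "submeasure (from_nat_into ?G n)" for n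
    by auto
  obtain K where K: "\<And>y. (\<forall>n. \<exists>e. prefix y (K * Suc (n + e))
      = run p (\<lambda>x. smn e x \<in> halting_set) (K * Suc (n + e))) \<Longrightarrow> y \<notin> MLR p"
    using not_MLR_if_run[OF p(1,2) assms(3)] by blast
  obtain y where y: "\<forall>n. \<exists>e. prefix y (K * Suc (n + e))
      = run p (\<lambda>x. smn e x \<in> halting_set) (K * Suc (n + e))"
    and bound: "\<And>i. \<exists>W N. \<forall>m>N. from_nat_into ?G i (prefix y m) \<le> real W * nu p (prefix y m)"
    using controlling_sequence[where \<delta> = "from_nat_into ?G" and K = K, OF p(3,2) G'] by blast
  obtain C where C: "0 < C" "\<And>\<tau>. nu p \<tau> \<le> C * mu_str p \<tau>"
    using nu_le_mu_str[OF p(1,2)] by blast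
  have "\<not> succeeds (blind_mart p \<delta>) y" if "semimeasure \<delta>" "left_ce \<delta>" for \<delta>
  proof -
    have "\<delta> \<in> range (from_nat_into ?G)" unfolding range using that by blast
    with bound obtain W N where W: "\<And>m. N < m \<Longrightarrow> \<delta> (prefix y m) \<le> real W * nu p (prefix y m)"
      by blast
    \<comment> \<open>The bound by W times \<open>nu\<close> and the comparison of \<open>nu\<close>
      with \<open>mu_str\<close> combine; dividing by the positive \<open>mu_str\<close> leaves a
      constant for all long prefixes.\<close>
    have "blind_mart p \<delta> (prefix y m) \<le> real W * C" if "N < m" for m
    proof -
      have "\<delta> (prefix y m) \<le> real W * (C * mu_str p (prefix y m))"
        using W[OF that] C(2)[of "prefix y m"] by (meson mult_left_mono of_nat_0_le_iff order_trans)
      then show ?thesis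
        using mu_str_pos[OF p(1,2), of "prefix y m"] by (simp add: blind_mart_def field_simps)
    qed
    then have "eventually (\<lambda>m. ereal (blind_mart p \<delta> (prefix y m)) \<le> ereal (real W * C)) sequentially"
      by (auto simp: eventually_at_top_dense)
    then have "limsup (\<lambda>m. ereal (blind_mart p \<delta> (prefix y m))) \<le> ereal (real W * C)"
      by (rule Limsup_bounded)
    then show ?thesis unfolding succeeds_def by auto
  qed
  with K[OF y] show ?thesis by blast
qed

end
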